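(* Let $G$ be a locally convex Lie group and let $f\colon M\to N$ be a smooth $G$-equivariant map between Fréchet $G$-manifolds. Let $m\in M$ and $\mu=f(m)$. Assume that the following conditions hold: (i) The stabilizer subgroup $G_\mu$ of $\mu$ is a Lie subgroup of $G$. (ii) The induced $G_\mu$-action on $M$ is proper and admits a slice $S$ at $m$. (iii) The induced $G_m$-action on $N$ can be linearized at $\mu$. (iv) The restriction $f_S:=f|_S\colon S\to N$ of $f$ to $S$ can be brought into a normal form at $m$ in a $G_m$-equivariant way. Then $f$ can be brought into an equivariant normal form at $m$.
   Context: Manifolds are smooth, modeled on locally convex spaces (Fréchet manifold: modeled on Fréchet spaces), without boundary. A $G$-manifold is a manifold with smooth $G$-action. $G_m$, $G_\mu$ denote stabilizers; by equivariance $G_m\subseteq G_\mu$. A chart at a point sends it to $0$. A subset $S\subseteq M$ is a submanifold if around each $s\in S$ there is a chart of $M$ mapping $S$ onto the intersection of the chart image with a closed linear subspace. Slice at $m$ for a $G_\mu$-action: a submanifold $S\ni m$ with: (SL1) $G_m\cdot S\subseteq S$; (SL2) if $g\in G_\mu$ and $(g\cdot S)\cap S\ne\emptyset$ then $g\in G_m$; (SL3) $G_m$ is a Lie subgroup for which $G_\mu\to G_\mu/G_m$ is a locally trivial principal bundle, and this bundle admits a local section $\chi\colon G_\mu/G_m\supseteq W\to G_\mu$ on an open neighborhood $W$ of $[e]$ such that $W\times S\to M$, $([g],s)\mapsto\chi([g])\cdot s$ is a diffeomorphism onto an open neighborhood of $m$; (SL4) $\{s\in S: (G_\mu)_s\text{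 conjugate to }G_m\}$ is a closed submanifold of $S$; (SL5) (linearity) there are a continuous representation of $G_m$ on a locally convex space $X$ and a $G_m$-equivariant diffeomorphism $\iota_S$ from a $G_m$-invariant open neighborhood of $0\in X$ onto $S$ with $\iota_S(0)=m$. The tube map $\chi^T\colon G_\mu\times_{G_m}S\to M$, $[g,s]\mapsto g\cdot s$ is a $G_\mu$-equivariant diffeomorphism onto an open neighborhood of $G_\mu\cdot m$. Linearization: an action of a group $H$ on $N$ with fixed point $\mu$ can be linearized at $\mu$ if there are an $H$-invariant open neighborhood $V'$ of $\mu$, a chart $\rho\colon V'\to Y$ at $\mu$ and a linear $H$-action on $Y$ making $\rho$ $H$-equivariant. Normal form: an abstract normal form is a tuple $(X,Y,\hat f,f_{\mathrm{sing}})$ where $X,Y$ are locally convex with topological direct sums $X=\mathrm{Ker}\oplus\mathrm{Coim}$, $Y=\mathrm{Coker}\oplus\mathrm{Im}$, $\hat f\colon\mathrm{Coim}\to\mathrm{Im}$ is a linear topological isomorphism, and $f_{\mathrm{sing}}\colon U\to\mathrm{Coker}$ is smooth on an open neighborhood $U$ of $0\in X$ with $f_{\mathrm{sing}}(0,x_2)=0$ for $x_2\in U\cap\mathrm{Coim}$ and $T_{(0,0)}f_{\mathrm{sing}}=0$. A smooth map $h\colon S\to N$ can be brought into this normal form at $m$ if there are charts $\kappa\colon U'\to U\subseteq X$ at $m$ and $\rho\colon V'\to V\subseteq Y$ at $h(m)$ with $h(U')\subseteq V'$ and $\rho\circ h|_{U'}(\kappa^{-1}(x_1,x_2))=\hat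 f(x_2)+f_{\mathrm{sing}}(x_1,x_2)$. It is brought into normal form in a $G_m$-equivariant way if in addition $X,Y$ carry linear $G_m$-actions leaving the decompositions invariant, the domains are $G_m$-invariant and $\kappa,\rho,\hat f,f_{\mathrm{sing}}$ are $G_m$-equivariant. Abstract equivariant normal form: a tuple $(H,X,Y,\hat f,f_{\mathrm{sing}})$ with $H$ a compact Lie group, $(X,Y,\hat f,f_{\mathrm{sing}})$ an abstract normal form such that $X,Y$ carry linear $H$-actions, the decompositions and $U$ are $H$-invariant, and $\hat f,f_{\mathrm{sing}}$ are $H$-equivariant. For a Lie group $G_\mu\supseteq H$ set $f_{\mathrm{NF}}\colon G_\mu\times_HU\to G_\mu\times_HY$, $f_{\mathrm{NF}}([g,x_1,x_2])=[g,\hat f(x_2)+f_{\mathrm{sing}}(x_1,x_2)]$. The map $f$ can be brought into an equivariant normal form at $m$ if for some abstract equivariant normal form with $H=G_m$ there exist a slice $S$ at $m$ for the $G_\mu$-action, a $G_m$-equivariant diffeomorphism $\iota_S\colon X\supseteq U\to S$, and a $G_m$-equivariant chart $\rho\colon N\supseteq V'\to V\subseteq Y$ at $\mu$ with $f(S)\subseteq V'$, such that $f\circ\chi^T\circ(\mathrm{id}_{G_\mu}\times\iota_S)=\rho^T\circ f_{\mathrm{NF}}$ on $G_\mu\times_{G_m}U$, where $\rho^T\colon G_\mu\times_{G_m}V\to N$, $\rho^T([g,y])=g\cdot\rho^{-1}(y)$. *)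

theory Defs
  imports
    "HOL-Analysis.Analysis"
    "HOL-Algebra.Group_Action"
    "HOL-Algebra.Left_Coset"
begin

section \<open>Locally convex spaces\<close>

class lcs = real_vector + t2_space + topological_ab_group_add +
  assumes tendsto_scaleR_nhds:
    "((\<lambda>p. fst p *\<^sub>R snd p) \<longlongrightarrow> c *\<^sub>R a) (nhds c \<times>\<^sub>F nhds a)"
  and ex_convex_nhds_0: "open U \<Longrightarrow> 0 \<in> U \<Longrightarrow> \<exists>C. open C \<and> 0 \<in> C \<and> C \<subseteq> U \<and>
    (\<forall>x\<in>C. \<forall>y\<in>C. \<forall>u\<ge>0. \<forall>v\<ge>0. u + v = 1 \<longrightarrow> u *\<^sub>R x + v *\<^sub>R y \<in> C)"

lemma convex_nhds_0:
  fixes U :: "'a::lcs set"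
  assumes "open U" "0 \<in> U"
  shows "\<exists>C. open C \<and> 0 \<in> C \<and> convex C \<and> C \<subseteq> U"
  using ex_convex_nhds_0[OF assms] unfolding convex_def by blast

instance prod :: (topological_monoid_add, topological_monoid_add) topological_monoid_add
proof
  fix a b :: "'a \<times> 'b"
  have "((\<lambda>x. fst x) \<longlongrightarrow> a) (nhds a \<times>\<^sub>F nhds b)" "((\<lambda>x. snd x) \<longlongrightarrow> b) (nhds a \<times>\<^sub>F nhds b)"
    by (simp_all add: filterlim_fst filterlim_snd)
  then have "((\<lambda>x. (fst (fst x) + fst (snd x), snd (fst x) + snd (snd x)))
      \<longlongrightarrow> (fst a + fst b, snd a + snd b)) (nhds a \<times>\<^sub>F nhds b)"
    by (intro tendsto_Pair tendsto_add tendsto_fst tendsto_snd)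
  then show "LIM x nhds a \<times>\<^sub>F nhds b. fst x + snd x :> nhds (a + b)"
    by (simp add: plus_prod_def)
qed

instance prod :: (topological_group_add, topological_group_add) topological_group_add
proof
  fix a :: "'a \<times> 'b"
  have "((\<lambda>x. x) \<longlongrightarrow> a) (nhds a)"
    by (simp add: filterlim_ident)
  then have "((\<lambda>x. (- fst x, - snd x)) \<longlongrightarrow> (- fst a, - snd a)) (nhds a)"
    by (intro tendsto_Pair tendsto_minus tendsto_fst tendsto_snd)
  then show "(uminus \<longlongrightarrow> - a) (nhds a)"
    by (simp add: uminus_prod_def[abs_def])
qed

instance prod :: (topological_ab_group_add, topological_ab_group_add) topological_ab_group_add ..

lemma tendsto_scaleR_lcs:
  fixes a :: "'a::lcs"
  assumes "(f \<longlongrightarrow> c) F" "(g \<longlongrightarrow> a) F"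
  shows "((\<lambda>x. f x *\<^sub>R g x) \<longlongrightarrow> c *\<^sub>R a) F"
  using filterlim_compose[OF tendsto_scaleR_nhds filterlim_Pair[OF assms]] by simp

instance prod :: (lcs, lcs) lcs
proof
  fix c :: real and a :: "'a \<times> 'b"
  have f: "((\<lambda>x. fst x) \<longlongrightarrow> c) (nhds c \<times>\<^sub>F nhds a)"
    and s: "((\<lambda>x. snd x) \<longlongrightarrow> a) (nhds c \<times>\<^sub>F nhds a)"
    by (simp_all add: filterlim_fst filterlim_snd)
  have "((\<lambda>x. (fst x *\<^sub>R fst (snd x), fst x *\<^sub>R snd (snd x)))
      \<longlongrightarrow> (c *\<^sub>R fst a, c *\<^sub>R snd a)) (nhds c \<times>\<^sub>F nhds a)"
    by (intro tendsto_Pair tendsto_scaleR_lcs tendsto_fst tendsto_snd f s)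
  then show "((\<lambda>p. fst p *\<^sub>R snd p) \<longlongrightarrow> c *\<^sub>R a) (nhds c \<times>\<^sub>F nhds a)"
    by (simp add: scaleR_prod_def)
next
  fix U :: "('a \<times> 'b) set"
  assume "open U" "0 \<in> U"
  then obtain A B where AB: "open A" "open B" "0 \<in> A \<times> B" "A \<times> B \<subseteq> U"
    by (rule open_prod_elim)
  then have "0 \<in> A" "0 \<in> B"
    by (simp_all add: zero_prod_def)
  obtain C where C: "open C" "0 \<in> C" "convex C" "C \<subseteq> A"
    using convex_nhds_0[OF \<open>open A\<close> \<open>0 \<in> A\<close>] by auto
  obtain D where D: "open D" "0 \<in> D" "convex D" "D \<subseteq> B"
    using convex_nhds_0[OF \<open>open B\<close> \<open>0 \<in> B\<close>] by auto
  have "C \<times> D \<subseteq> U"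
    using Sigma_mono[of C A "\<lambda>_. D" "\<lambda>_. B"] C(4) D(4) AB(4) by (meson order_trans)
  moreover have "open (C \<times> D)" "0 \<in> C \<times> D" "convex (C \<times> D)"
    using C D by (simp_all add: open_Times convex_Times zero_prod_def)
  ultimately show "\<exists>C. open C \<and> 0 \<in> C \<and> C \<subseteq> U \<and>
      (\<forall>x\<in>C. \<forall>y\<in>C. \<forall>u\<ge>0. \<forall>v\<ge>0. u + v = 1 \<longrightarrow> u *\<^sub>R x + v *\<^sub>R y \<in> C)"
    unfolding convex_def by (intro exI[of _ "C \<times> D"] conjI)
qed

text \<open>
  A locally convex space is a linear subspace of a type of class \<open>lcs\<close>, with the subspace
  topology (for the whole type, take \<open>UNIV\<close>).  Existential quantification over locally convex
  spaces is quantification over subspaces of a type that is left variable: definitions that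
  contain such a quantifier take the type as an argument of type \<open>_ itself\<close>.
\<close>

definition linear_between :: "'a::lcs set \<Rightarrow> 'b::lcs set \<Rightarrow> ('a \<Rightarrow> 'b) \<Rightarrow> bool" where
  "linear_between X Y f \<longleftrightarrow> f ` X \<subseteq> Y \<and>
     (\<forall>x\<in>X. \<forall>y\<in>X. f (x + y) = f x + f y) \<and> (\<forall>c. \<forall>x\<in>X. f (c *\<^sub>R x) = c *\<^sub>R f x)"

definition linear_homeomorphism :: "'a::lcs set \<Rightarrow> 'b::lcs set \<Rightarrow> ('a \<Rightarrow> 'b) \<Rightarrow> bool" where
  "linear_homeomorphism X Y f \<longleftrightarrow>
     linear_between X Y f \<and> homeomorphic_map (top_of_set X) (top_of_set Y) f"

definition topological_direct_sum :: "'a::lcs set \<Rightarrow> 'a set \<Rightarrow> 'a set \<Rightarrow> bool" where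
  "topological_direct_sum X A B \<longleftrightarrow> subspace X \<and> subspace A \<and> subspace B \<and>
     homeomorphic_map (prod_topology (top_of_set A) (top_of_set B)) (top_of_set X) (\<lambda>(a, b). a + b)"

text \<open>The component in \<open>B\<close> of an element of the direct sum of \<open>A\<close> and \<open>B\<close>.\<close>

definition snd_component :: "'a::lcs set \<Rightarrow> 'a set \<Rightarrow> 'a \<Rightarrow> 'a" where
  "snd_component A B x = (THE b. b \<in> B \<and> x - b \<in> A)"

definition frechet_space :: "'a::lcs set \<Rightarrow> bool" where
  "frechet_space X \<longleftrightarrow> subspace X \<and>
     (\<exists>d. Metric_space X d \<and> Metric_space.mtopology X d = top_of_set X \<and>
          Metric_space.mcomplete X d \<and> (\<forall>x\<in>X. \<forall>y\<in>X. \<forall>z\<in>X. d (x + z) (y + z) = d x y))"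


section \<open>Smooth maps between locally convex spaces\<close>

definition dir_quotient :: "('a::lcs \<Rightarrow> 'b::lcs) \<Rightarrow> 'a \<Rightarrow> 'a \<Rightarrow> real \<Rightarrow> 'b" where
  "dir_quotient f x v t = (f (x + t *\<^sub>R v) - f x) /\<^sub>R t"

definition dir_deriv :: "('a::lcs \<Rightarrow> 'b::lcs) \<Rightarrow> 'a \<Rightarrow> 'a \<Rightarrow> 'b" where
  "dir_deriv f x v = Lim (at 0) (dir_quotient f x v)"

text \<open>
  The iterated directional derivative of order \<open>k\<close> at \<open>x\<close> in the directions
  \<open>v 0, \<dots>, v (k - 1)\<close>; the other entries of \<open>v\<close> are irrelevant.
\<close>

primrec iter_deriv :: "('a::lcs \<Rightarrow> 'b::lcs) \<Rightarrow> nat \<Rightarrow> (nat \<Rightarrow> 'a) \<Rightarrow> 'a \<Rightarrow> 'b" where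
  "iter_deriv f 0 v x = f x"
| "iter_deriv f (Suc k) v x = dir_deriv (iter_deriv f k v) x (v k)"

text \<open>
  Michal-Bastiani smoothness of \<open>f : U \<rightarrow> Y\<close>, for \<open>U\<close> open in the locally convex space \<open>X\<close>: all
  iterated directional derivatives exist in \<open>Y\<close> and are jointly continuous in the point and the
  directions.  As \<open>Y\<close> need not be closed in its type, it has to be required that the limits
  lie in \<open>Y\<close>.
\<close>

definition smooth_on :: "'a::lcs set \<Rightarrow> 'a set \<Rightarrow> 'b::lcs set \<Rightarrow> ('a \<Rightarrow> 'b) \<Rightarrow> bool" where
  "smooth_on X U Y f \<longleftrightarrow> f ` U \<subseteq> Y \<and>
     (\<forall>k. (\<forall>x\<in>U. \<forall>v. range v \<subseteq> X \<longrightarrow>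
             (\<exists>w\<in>Y. (dir_quotient (iter_deriv f k v) x (v k) \<longlongrightarrow> w) (at 0))) \<and>
          continuous_on (U \<times> {v. range v \<subseteq> X}) (\<lambda>(x, v). iter_deriv f k v x))"


section \<open>Manifolds\<close>

record ('p, 'e) chart =
  cdom :: "'p set"
  cmap :: "'p \<Rightarrow> 'e"
  cmodel :: "'e set"

record ('p, 'e) mfd =
  mtop :: "'p topology"
  atlas :: "('p, 'e) chart set"

abbreviation points :: "('p, 'e) mfd \<Rightarrow> 'p set" where
  "points M \<equiv> topspace (mtop M)"

definition top_chart :: "'p topology \<Rightarrow> ('p, 'e::lcs) chart \<Rightarrow> bool" where
  "top_chart T c \<longleftrightarrow> openin T (cdom c) \<and> subspace (cmodel c) \<and>
     openin (top_of_set (cmodel c)) (cmap c ` cdom c) \<and>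
     homeomorphic_map (subtopology T (cdom c)) (top_of_set (cmap c ` cdom c)) (cmap c)"

definition smooth_transition :: "('p, 'e::lcs) chart \<Rightarrow> ('p, 'e) chart \<Rightarrow> bool" where
  "smooth_transition c d \<longleftrightarrow>
     smooth_on (cmodel c) (cmap c ` (cdom c \<inter> cdom d)) (cmodel d) (cmap d \<circ> inv_into (cdom c) (cmap c))"

definition manifold :: "('p, 'e::lcs) mfd \<Rightarrow> bool" where
  "manifold M \<longleftrightarrow> Hausdorff_space (mtop M) \<and> (\<forall>c\<in>atlas M. top_chart (mtop M) c) \<and>
     \<Union> (cdom ` atlas M) = points M \<and> (\<forall>c\<in>atlas M. \<forall>d\<in>atlas M. smooth_transition c d)"

definition frechet_manifold :: "('p, 'e::lcs) mfd \<Rightarrow> bool" where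
  "frechet_manifold M \<longleftrightarrow> manifold M \<and> (\<forall>c\<in>atlas M. frechet_space (cmodel c))"

definition maximal_atlas :: "('p, 'e::lcs) mfd \<Rightarrow> ('p, 'e) chart set" where
  "maximal_atlas M = {c. top_chart (mtop M) c \<and>
     (\<forall>d\<in>atlas M. smooth_transition c d \<and> smooth_transition d c)}"

text \<open>Smoothness of a map defined on an open subset \<open>A\<close> of \<open>M\<close>, tested in the atlases.\<close>

definition smooth_map ::
  "('p, 'e::lcs) mfd \<Rightarrow> 'p set \<Rightarrow> ('q, 'f::lcs) mfd \<Rightarrow> ('p \<Rightarrow> 'q) \<Rightarrow> bool" where
  "smooth_map M A N f \<longleftrightarrow> continuous_map (subtopology (mtop M) A) (mtop N) f \<and>
     (\<forall>c\<in>atlas M. \<forall>d\<in>atlas N.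
        smooth_on (cmodel c) (cmap c ` {x \<in> cdom c \<inter> A. f x \<in> cdom d}) (cmodel d)
          (cmap d \<circ> f \<circ> inv_into (cdom c) (cmap c)))"

text \<open>\<open>f\<close> is a diffeomorphism from the open subset \<open>A\<close> of \<open>M\<close> onto the open subset \<open>B\<close> of \<open>N\<close>.\<close>

definition diffeo ::
  "('p, 'e::lcs) mfd \<Rightarrow> 'p set \<Rightarrow> ('q, 'f::lcs) mfd \<Rightarrow> 'q set \<Rightarrow> ('p \<Rightarrow> 'q) \<Rightarrow> bool" where
  "diffeo M A N B f \<longleftrightarrow> openin (mtop M) A \<and> openin (mtop N) B \<and> bij_betw f A B \<and>
     smooth_map M A N f \<and> smooth_map N B M (inv_into A f)"

definition lcs_mfd :: "'e::lcs set \<Rightarrow> ('e, 'e) mfd" where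
  "lcs_mfd X = \<lparr>mtop = top_of_set X, atlas = {\<lparr>cdom = X, cmap = id, cmodel = X\<rparr>}\<rparr>"

definition prod_mfd ::
  "('p, 'e::lcs) mfd \<Rightarrow> ('q, 'f::lcs) mfd \<Rightarrow> ('p \<times> 'q, 'e \<times> 'f) mfd" where
  "prod_mfd M N = \<lparr>mtop = prod_topology (mtop M) (mtop N),
     atlas = {\<lparr>cdom = cdom c \<times> cdom d, cmap = map_prod (cmap c) (cmap d),
               cmodel = cmodel c \<times> cmodel d\<rparr> | c d. c \<in> atlas M \<and> d \<in> atlas N}\<rparr>"

text \<open>
  A chart of \<open>M\<close> at \<open>p\<close> with values in a locally convex space \<open>X\<close> of a possibly different type,
  with domain \<open>U'\<close> and image \<open>U\<close>.
\<close>

definition chart_at ::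
  "('p, 'e::lcs) mfd \<Rightarrow> 'p \<Rightarrow> 'p set \<Rightarrow> ('p \<Rightarrow> 'x::lcs) \<Rightarrow> 'x set \<Rightarrow> 'x set \<Rightarrow> bool" where
  "chart_at M p U' \<kappa> U X \<longleftrightarrow> subspace X \<and> p \<in> U' \<and> \<kappa> p = 0 \<and> diffeo M U' (lcs_mfd X) U \<kappa>"


subsection \<open>Submanifolds\<close>

definition adapted_chart ::
  "('p, 'e::lcs) mfd \<Rightarrow> 'p set \<Rightarrow> ('p, 'e) chart \<Rightarrow> 'e set \<Rightarrow> bool" where
  "adapted_chart M S c F \<longleftrightarrow> c \<in> maximal_atlas M \<and> subspace F \<and>
     closedin (top_of_set (cmodel c)) F \<and> cmap c ` (cdom c \<inter> S) = cmap c ` cdom c \<inter> F"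

definition submanifold :: "('p, 'e::lcs) mfd \<Rightarrow> 'p set \<Rightarrow> bool" where
  "submanifold M S \<longleftrightarrow> S \<subseteq> points M \<and> (\<forall>s\<in>S. \<exists>c F. s \<in> cdom c \<and> adapted_chart M S c F)"

definition submfd :: "('p, 'e::lcs) mfd \<Rightarrow> 'p set \<Rightarrow> ('p, 'e) mfd" where
  "submfd M S = \<lparr>mtop = subtopology (mtop M) S,
     atlas = {\<lparr>cdom = cdom c \<inter> S, cmap = cmap c, cmodel = F\<rparr> | c F. adapted_chart M S c F}\<rparr>"


section \<open>Lie groups and actions\<close>

record ('g, 'l) lie = "'g monoid" +
  gmfd :: "('g, 'l) mfd"

abbreviation gtop :: "('g, 'l) lie \<Rightarrow> 'g topology" where
  "gtop G \<equiv> mtop (gmfd G)"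

definition lie_group :: "('g, 'l::lcs) lie \<Rightarrow> bool" where
  "lie_group G \<longleftrightarrow> group G \<and> manifold (gmfd G) \<and> points (gmfd G) = carrier G \<and>
     smooth_map (prod_mfd (gmfd G) (gmfd G)) (carrier G \<times> carrier G) (gmfd G) (\<lambda>(g, h). g \<otimes>\<^bsub>G\<^esub> h) \<and>
     smooth_map (gmfd G) (carrier G) (gmfd G) (\<lambda>g. inv\<^bsub>G\<^esub> g)"

definition lie_restrict :: "('g, 'l::lcs) lie \<Rightarrow> 'g set \<Rightarrow> ('g, 'l) lie" where
  "lie_restrict G H = G\<lparr>carrier := H, gmfd := submfd (gmfd G) H\<rparr>"

definition lie_subgroup :: "('g, 'l::lcs) lie \<Rightarrow> 'g set \<Rightarrow> bool" where
  "lie_subgroup G H \<longleftrightarrow> subgroup H G \<and> submanifold (gmfd G) H \<and> lie_group (lie_restrict G H)"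

definition isotropy :: "('g, 'l::lcs) lie \<Rightarrow> ('g \<Rightarrow> 'p \<Rightarrow> 'p) \<Rightarrow> 'p \<Rightarrow> ('g, 'l) lie" where
  "isotropy G \<phi> x = lie_restrict G (stabilizer G \<phi> x)"

definition g_manifold ::
  "('g, 'l::lcs) lie \<Rightarrow> ('p, 'e::lcs) mfd \<Rightarrow> ('g \<Rightarrow> 'p \<Rightarrow> 'p) \<Rightarrow> bool" where
  "g_manifold G M \<phi> \<longleftrightarrow> manifold M \<and> group_action G (points M) \<phi> \<and>
     smooth_map (prod_mfd (gmfd G) M) (carrier G \<times> points M) M (\<lambda>(g, x). \<phi> g x)"

definition proper_action ::
  "('g, 'l::lcs) lie \<Rightarrow> ('p, 'e::lcs) mfd \<Rightarrow> ('g \<Rightarrow> 'p \<Rightarrow> 'p) \<Rightarrow> bool" where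
  "proper_action G M \<phi> \<longleftrightarrow>
     proper_map (prod_topology (gtop G) (mtop M)) (prod_topology (mtop M) (mtop M))
       (\<lambda>(g, x). (\<phi> g x, x))"

text \<open>Linear actions are continuous representations.\<close>

definition linear_action ::
  "('g, 'l::lcs) lie \<Rightarrow> 'x::lcs set \<Rightarrow> ('g \<Rightarrow> 'x \<Rightarrow> 'x) \<Rightarrow> bool" where
  "linear_action H X A \<longleftrightarrow> subspace X \<and> group_action H X A \<and>
     (\<forall>h\<in>carrier H. linear_between X X (A h)) \<and>
     continuous_map (prod_topology (gtop H) (top_of_set X)) (top_of_set X) (\<lambda>(h, x). A h x)"

definition invariant_set :: "('g, 'l) lie \<Rightarrow> ('g \<Rightarrow> 'p \<Rightarrow> 'p) \<Rightarrow> 'p set \<Rightarrow> bool" where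
  "invariant_set H \<phi> U \<longleftrightarrow> (\<forall>h\<in>carrier H. \<phi> h ` U \<subseteq> U)"

definition equivariant_on ::
  "('g, 'l) lie \<Rightarrow> ('g \<Rightarrow> 'p \<Rightarrow> 'p) \<Rightarrow> ('g \<Rightarrow> 'q \<Rightarrow> 'q) \<Rightarrow> 'p set \<Rightarrow> ('p \<Rightarrow> 'q) \<Rightarrow> bool" where
  "equivariant_on H \<phi> \<psi> U f \<longleftrightarrow> (\<forall>h\<in>carrier H. \<forall>x\<in>U. f (\<phi> h x) = \<psi> h (f x))"

definition linearizable ::
  "'y::lcs itself \<Rightarrow> ('g, 'l::lcs) lie \<Rightarrow> ('q, 'f::lcs) mfd \<Rightarrow> ('g \<Rightarrow> 'q \<Rightarrow> 'q) \<Rightarrow> 'q \<Rightarrow> bool" where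
  "linearizable TYPE('y) H N \<psi> \<mu> \<longleftrightarrow>
     (\<exists>(Y :: 'y set) B V' \<rho> V. linear_action H Y B \<and> chart_at N \<mu> V' \<rho> V Y \<and>
        invariant_set H \<psi> V' \<and> equivariant_on H \<psi> B V' \<rho>)"


section \<open>Slices\<close>

text \<open>
  \<open>Q\<close> is a manifold structure on \<open>K / H\<close> that makes \<open>K \<rightarrow> K / H\<close> a locally trivial principal
  bundle.  The model spaces of \<open>Q\<close> may be taken in the type \<open>'l\<close> of those of \<open>K\<close>: by local
  triviality they are isomorphic to complements of model spaces of \<open>H\<close> in those of \<open>K\<close>.
\<close>

definition principal_quotient ::
  "('g, 'l::lcs) lie \<Rightarrow> 'g set \<Rightarrow> ('g set, 'l) mfd \<Rightarrow> bool" where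
  "principal_quotient K H Q \<longleftrightarrow> manifold Q \<and> points Q = lcosets\<^bsub>K\<^esub> H \<and>
     (\<forall>q\<in>points Q. \<exists>W \<Phi>. openin (mtop Q) W \<and> q \<in> W \<and>
        diffeo (prod_mfd Q (submfd (gmfd K) H)) (W \<times> H)
          (gmfd K) {g \<in> carrier K. g <#\<^bsub>K\<^esub> H \<in> W} \<Phi> \<and>
        (\<forall>w\<in>W. \<forall>h\<in>H. \<Phi> (w, h) <#\<^bsub>K\<^esub> H = w) \<and>
        (\<forall>w\<in>W. \<forall>h\<in>H. \<forall>h'\<in>H. \<Phi> (w, h \<otimes>\<^bsub>K\<^esub> h') = \<Phi> (w, h) \<otimes>\<^bsub>K\<^esub> h'))"

definition slice ::
  "'x::lcs itself \<Rightarrow> ('g, 'l::lcs) lie \<Rightarrow> ('p, 'e::lcs) mfd \<Rightarrow> ('g \<Rightarrow> 'p \<Rightarrow> 'p) \<Rightarrow> 'p \<Rightarrow> 'p set \<Rightarrow> bool"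
  where
  "slice TYPE('x) K M \<phi> m S \<longleftrightarrow> submanifold M S \<and> m \<in> S \<and>
     (\<forall>g\<in>stabilizer K \<phi> m. \<phi> g ` S \<subseteq> S) \<and>
     (\<forall>g\<in>carrier K. \<phi> g ` S \<inter> S \<noteq> {} \<longrightarrow> g \<in> stabilizer K \<phi> m) \<and>
     lie_subgroup K (stabilizer K \<phi> m) \<and>
     (\<exists>Q W \<sigma> B. principal_quotient K (stabilizer K \<phi> m) Q \<and>
        openin (mtop Q) W \<and> \<one>\<^bsub>K\<^esub> <#\<^bsub>K\<^esub> stabilizer K \<phi> m \<in> W \<and>
        smooth_map Q W (gmfd K) \<sigma> \<and> (\<forall>w\<in>W. \<sigma> w <#\<^bsub>K\<^esub> stabilizer K \<phi> m = w) \<and>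
        m \<in> B \<and> diffeo (prod_mfd Q (submfd M S)) (W \<times> S) M B (\<lambda>(w, s). \<phi> (\<sigma> w) s)) \<and>
     (let T = {s \<in> S. \<exists>g\<in>carrier K.
                 stabilizer K \<phi> s = (\<lambda>h. g \<otimes>\<^bsub>K\<^esub> h \<otimes>\<^bsub>K\<^esub> inv\<^bsub>K\<^esub> g) ` stabilizer K \<phi> m}
      in closedin (mtop (submfd M S)) T \<and> submanifold (submfd M S) T) \<and>
     (\<exists>(X :: 'x set) A U \<iota>. linear_action (isotropy K \<phi> m) X A \<and>
        0 \<in> U \<and> invariant_set (isotropy K \<phi> m) A U \<and> diffeo (lcs_mfd X) U (submfd M S) S \<iota> \<and>
        equivariant_on (isotropy K \<phi> m) A \<phi> U \<iota> \<and> \<iota> 0 = m)"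


section \<open>Associated bundles\<close>

text \<open>\<open>K \<times>\<^sub>H U\<close> is the quotient of \<open>K \<times> U\<close> by \<open>(g h, x) \<sim> (g, h x)\<close>.\<close>

definition assoc_rel ::
  "('g, 'l) lie \<Rightarrow> 'g set \<Rightarrow> ('g \<Rightarrow> 'x \<Rightarrow> 'x) \<Rightarrow> 'x set \<Rightarrow> (('g \<times> 'x) \<times> ('g \<times> 'x)) set" where
  "assoc_rel K H A U = {((g, x), (g', x')). g \<in> carrier K \<and> x \<in> U \<and> g' \<in> carrier K \<and> x' \<in> U \<and>
     (\<exists>h\<in>H. g = g' \<otimes>\<^bsub>K\<^esub> h \<and> x' = A h x)}"

definition assoc_class ::
  "('g, 'l) lie \<Rightarrow> 'g set \<Rightarrow> ('g \<Rightarrow> 'x \<Rightarrow> 'x) \<Rightarrow> 'x set \<Rightarrow> 'g \<times> 'x \<Rightarrow> ('g \<times> 'x) set" where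
  "assoc_class K H A U p = assoc_rel K H A U `` {p}"

definition assoc_bundle ::
  "('g, 'l) lie \<Rightarrow> 'g set \<Rightarrow> ('g \<Rightarrow> 'x \<Rightarrow> 'x) \<Rightarrow> 'x set \<Rightarrow> ('g \<times> 'x) set set" where
  "assoc_bundle K H A U = (carrier K \<times> U) // assoc_rel K H A U"

text \<open>The map on classes induced by a map \<open>F\<close> that is constant on classes.\<close>

definition descend :: "('a \<Rightarrow> 'b) \<Rightarrow> 'a set \<Rightarrow> 'b" where
  "descend F C = the_elem (F ` C)"

text \<open>\<open>[g, x] \<mapsto> [g, k x]\<close>, with values in the bundle with fibre \<open>U'\<close>, and \<open>[g, x] \<mapsto> g \<cdot> k x\<close>.\<close>

definition assoc_map ::
  "('g, 'l) lie \<Rightarrow> 'g set \<Rightarrow> ('g \<Rightarrow> 'y \<Rightarrow> 'y) \<Rightarrow> 'y set \<Rightarrow> ('x \<Rightarrow> 'y) \<Rightarrow> ('g \<times> 'x) set \<Rightarrow> ('g \<times> 'y) set"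
  where
  "assoc_map K H A' U' k = descend (\<lambda>(g, x). assoc_class K H A' U' (g, k x))"

definition tube_map :: "('g \<Rightarrow> 'p \<Rightarrow> 'p) \<Rightarrow> ('x \<Rightarrow> 'p) \<Rightarrow> ('g \<times> 'x) set \<Rightarrow> 'p" where
  "tube_map \<phi> k = descend (\<lambda>(g, x). \<phi> g (k x))"


section \<open>Normal forms\<close>

record ('x, 'y) normal_form =
  nf_X :: "'x set"
  nf_Ker :: "'x set"
  nf_Coim :: "'x set"
  nf_Y :: "'y set"
  nf_Coker :: "'y set"
  nf_Im :: "'y set"
  nf_hat :: "'x \<Rightarrow> 'y"
  nf_dom :: "'x set"
  nf_sing :: "'x \<Rightarrow> 'y"

text \<open>\<open>(x\<^sub>1, x\<^sub>2) \<in> Ker \<oplus> Coim\<close> is represented by the sum \<open>x\<^sub>1 + x\<^sub>2 \<in> X\<close>.\<close>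

definition abstract_normal_form :: "('x::lcs, 'y::lcs) normal_form \<Rightarrow> bool" where
  "abstract_normal_form nf \<longleftrightarrow>
     topological_direct_sum (nf_X nf) (nf_Ker nf) (nf_Coim nf) \<and>
     topological_direct_sum (nf_Y nf) (nf_Coker nf) (nf_Im nf) \<and>
     linear_homeomorphism (nf_Coim nf) (nf_Im nf) (nf_hat nf) \<and>
     openin (top_of_set (nf_X nf)) (nf_dom nf) \<and> 0 \<in> nf_dom nf \<and>
     smooth_on (nf_X nf) (nf_dom nf) (nf_Coker nf) (nf_sing nf) \<and>
     (\<forall>x \<in> nf_dom nf \<inter> nf_Coim nf. nf_sing nf x = 0) \<and>
     (\<forall>v \<in> nf_X nf. dir_deriv (nf_sing nf) 0 v = 0)"

text \<open>\<open>(x\<^sub>1, x\<^sub>2) \<mapsto> nf_hat x\<^sub>2 + nf_sing (x\<^sub>1, x\<^sub>2)\<close>\<close>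

definition nf_map :: "('x::lcs, 'y::lcs) normal_form \<Rightarrow> 'x \<Rightarrow> 'y" where
  "nf_map nf x = nf_hat nf (snd_component (nf_Ker nf) (nf_Coim nf) x) + nf_sing nf x"

definition in_normal_form ::
  "('s, 'e::lcs) mfd \<Rightarrow> ('q, 'f::lcs) mfd \<Rightarrow> ('s \<Rightarrow> 'q) \<Rightarrow> 's \<Rightarrow> ('x::lcs, 'y::lcs) normal_form \<Rightarrow>
   's set \<Rightarrow> ('s \<Rightarrow> 'x) \<Rightarrow> 'q set \<Rightarrow> ('q \<Rightarrow> 'y) \<Rightarrow> 'y set \<Rightarrow> bool" where
  "in_normal_form S N h m nf U' \<kappa> V' \<rho> V \<longleftrightarrow>
     abstract_normal_form nf \<and>
     chart_at S m U' \<kappa> (nf_dom nf) (nf_X nf) \<and> chart_at N (h m) V' \<rho> V (nf_Y nf) \<and>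
     h ` U' \<subseteq> V' \<and> (\<forall>x\<in>nf_dom nf. \<rho> (h (inv_into U' \<kappa> x)) = nf_map nf x)"

definition equivariant_nf_data ::
  "('g, 'l::lcs) lie \<Rightarrow> ('x::lcs, 'y::lcs) normal_form \<Rightarrow> ('g \<Rightarrow> 'x \<Rightarrow> 'x) \<Rightarrow> ('g \<Rightarrow> 'y \<Rightarrow> 'y) \<Rightarrow> bool"
  where
  "equivariant_nf_data H nf A B \<longleftrightarrow>
     linear_action H (nf_X nf) A \<and> linear_action H (nf_Y nf) B \<and>
     invariant_set H A (nf_Ker nf) \<and> invariant_set H A (nf_Coim nf) \<and>
     invariant_set H B (nf_Coker nf) \<and> invariant_set H B (nf_Im nf) \<and>
     invariant_set H A (nf_dom nf) \<and>
     equivariant_on H A B (nf_Coim nf) (nf_hat nf) \<and>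
     equivariant_on H A B (nf_dom nf) (nf_sing nf)"

definition has_normal_form_equivariantly ::
  "'x::lcs itself \<Rightarrow> 'y::lcs itself \<Rightarrow> ('g, 'l::lcs) lie \<Rightarrow>
   ('s, 'e::lcs) mfd \<Rightarrow> ('g \<Rightarrow> 's \<Rightarrow> 's) \<Rightarrow> ('q, 'f::lcs) mfd \<Rightarrow> ('g \<Rightarrow> 'q \<Rightarrow> 'q) \<Rightarrow>
   ('s \<Rightarrow> 'q) \<Rightarrow> 's \<Rightarrow> bool" where
  "has_normal_form_equivariantly TYPE('x) TYPE('y) H S \<phi> N \<psi> h m \<longleftrightarrow>
     (\<exists>(nf :: ('x, 'y) normal_form) U' \<kappa> V' \<rho> V A B.
        in_normal_form S N h m nf U' \<kappa> V' \<rho> V \<and> equivariant_nf_data H nf A B \<and>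
        invariant_set H \<phi> U' \<and> invariant_set H \<psi> V' \<and>
        equivariant_on H \<phi> A U' \<kappa> \<and> equivariant_on H \<psi> B V' \<rho>)"

definition abstract_equivariant_normal_form ::
  "('g, 'l::lcs) lie \<Rightarrow> ('x::lcs, 'y::lcs) normal_form \<Rightarrow> ('g \<Rightarrow> 'x \<Rightarrow> 'x) \<Rightarrow> ('g \<Rightarrow> 'y \<Rightarrow> 'y) \<Rightarrow> bool"
  where
  "abstract_equivariant_normal_form H nf A B \<longleftrightarrow>
     lie_group H \<and> compact_space (gtop H) \<and> abstract_normal_form nf \<and> equivariant_nf_data H nf A B"

text \<open>
  With \<open>f\<^sub>N\<^sub>F = assoc_map K H B Y (nf_map nf)\<close>, the last two lines say that \<open>f\<^sub>N\<^sub>F\<close> maps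
  \<open>K \<times>\<^sub>H U\<close> into \<open>K \<times>\<^sub>H V\<close>, the domain of \<open>\<rho>\<^sup>T\<close>, and that
  \<open>f \<circ> \<chi>\<^sup>T \<circ> (id \<times> \<iota>) = \<rho>\<^sup>T \<circ> f\<^sub>N\<^sub>F\<close>.
\<close>

definition has_equivariant_normal_form ::
  "'x::lcs itself \<Rightarrow> 'y::lcs itself \<Rightarrow> ('g, 'l::lcs) lie \<Rightarrow>
   ('p, 'e::lcs) mfd \<Rightarrow> ('g \<Rightarrow> 'p \<Rightarrow> 'p) \<Rightarrow> ('q, 'f::lcs) mfd \<Rightarrow> ('g \<Rightarrow> 'q \<Rightarrow> 'q) \<Rightarrow>
   ('p \<Rightarrow> 'q) \<Rightarrow> 'p \<Rightarrow> bool" where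
  "has_equivariant_normal_form TYPE('x) TYPE('y) G M \<phi> N \<psi> f m \<longleftrightarrow>
     (let K = isotropy G \<psi> (f m); Hm = isotropy K \<phi> m; H = carrier Hm in
      \<exists>(nf :: ('x, 'y) normal_form) A B S \<iota> V' \<rho> V.
        abstract_equivariant_normal_form Hm nf A B \<and>
        slice TYPE('x) K M \<phi> m S \<and>
        diffeo (lcs_mfd (nf_X nf)) (nf_dom nf) (submfd M S) S \<iota> \<and> \<iota> 0 = m \<and>
        equivariant_on Hm A \<phi> (nf_dom nf) \<iota> \<and>
        chart_at N (f m) V' \<rho> V (nf_Y nf) \<and> invariant_set Hm \<psi> V' \<and>
        equivariant_on Hm \<psi> B V' \<rho> \<and> f ` S \<subseteq> V' \<and>
        (\<forall>C \<in> assoc_bundle K H A (nf_dom nf).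
           assoc_map K H B (nf_Y nf) (nf_map nf) C \<in> assoc_bundle K H B V \<and>
           f (tube_map \<phi> id (assoc_map K H \<phi> S \<iota> C)) =
             tube_map \<psi> (inv_into V' \<rho>) (assoc_map K H B (nf_Y nf) (nf_map nf) C)))"

end

theory Submission
  imports Defs
begin

text \<open>
  The normal form of \<open>f\<close> on the slice \<open>S\<close> lives on an invariant open neighbourhood \<open>U\<close> of \<open>m\<close> in
  \<open>S\<close>, the domain of an equivariant chart \<open>\<kappa>\<close>.  The idea is to replace \<open>S\<close> by \<open>U\<close>: an invariant open
  neighbourhood of \<open>m\<close> in a slice is again a slice as soon as it has an equivariant linear model
  (\<open>slice_open_subset\<close>), and the inverse \<open>\<iota>\<close> of \<open>\<kappa>\<close> is such a model, defined on the domain of the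
  abstract normal form.  On that domain \<open>f \<circ> \<iota> = \<rho>\<inverse> \<circ> nf_map\<close> holds by the choice of the charts.

  Equivariance then carries this identity along the orbits.  Let \<open>K\<close> be the stabilizer of \<open>f m\<close>.  For
  \<open>g\<close> in \<open>K\<close>, the tube map of \<open>U\<close> sends \<open>[g, x]\<close> to \<open>g \<iota>(x)\<close>, and \<open>f (g \<iota>(x)) = g f(\<iota>(x))\<close>, which
  is \<open>g \<rho>\<inverse>(nf_map x)\<close>, the image of \<open>[g, nf_map x]\<close> under the tube map of \<open>\<rho>\<close>.  The maps on
  associated bundles are computed on representatives by \<open>assoc_map_assoc_class\<close> and
  \<open>tube_map_assoc_class\<close>.  Compactness of the stabilizer of \<open>m\<close> in \<open>K\<close>, which an equivariant normal
  form demands, is a consequence of properness (\<open>compact_isotropy\<close>).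

  Most of the work is the passage from \<open>S\<close> to its open subset \<open>U\<close>: the submanifold structures, smooth
  maps and diffeomorphisms of the slice axioms have to be restricted.  The two ingredients are the
  local nature of iterated directional derivatives (\<open>smooth_on_cong\<close>) and the fact that the charts of
  \<open>U\<close> are among those of \<open>S\<close> (\<open>open_piece_submfd\<close>).
\<close>

section \<open>Locality of smoothness\<close>

lemma smooth_on_subset:
  assumes "smooth_on X U Y f" and "U' \<subseteq> U"
  shows "smooth_on X U' Y f"
  unfolding smooth_on_def
proof (intro conjI allI ballI impI)
  show "f ` U' \<subseteq> Y"
    using assms unfolding smooth_on_def by blast
next
  fix k x and v :: "nat \<Rightarrow> 'a"
  assume "x \<in> U'" "range v \<subseteq> X"
  then show "\<exists>w\<in>Y. (dir_quotient (iter_deriv f k v) x (v k) \<longlongrightarrow> w) (at 0)"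
    using assms unfolding smooth_on_def by blast
next
  fix k
  have "continuous_on (U \<times> {v. range v \<subseteq> X}) (\<lambda>(x, v). iter_deriv f k v x)"
    using assms unfolding smooth_on_def by blast
  then show "continuous_on (U' \<times> {v. range v \<subseteq> X}) (\<lambda>(x, v). iter_deriv f k v x)"
    by (rule continuous_on_subset) (use assms(2) in blast)
qed

text \<open>
  Near \<open>0\<close>, a directional difference quotient at a point of \<open>U\<close> only sees values on \<open>U\<close>.  This is
  what makes smoothness on an open set independent of the values outside it.
\<close>

lemma eventually_line_in_open:
  fixes X :: "'a::lcs set"
  assumes "subspace X" and "openin (top_of_set X) U" and "x \<in> U" and "v \<in> X"
  shows "eventually (\<lambda>t. x + t *\<^sub>R v \<in> U) (at (0::real))"
proof -
  obtain O' where O': "open O'" "U = X \<inter> O'"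
    using assms(2) unfolding openin_open by blast
  have "((\<lambda>t. t *\<^sub>R v) \<longlongrightarrow> 0 *\<^sub>R v) (at (0::real))"
    by (intro tendsto_scaleR_lcs tendsto_ident_at tendsto_const)
  then have "((\<lambda>t. x + t *\<^sub>R v) \<longlongrightarrow> x + 0 *\<^sub>R v) (at (0::real))"
    by (intro tendsto_add tendsto_const)
  then have "((\<lambda>t. x + t *\<^sub>R v) \<longlongrightarrow> x) (at (0::real))"
    by simp
  then have "eventually (\<lambda>t. x + t *\<^sub>R v \<in> O') (at (0::real))"
    using O' assms(3) topological_tendstoD by blast
  moreover have "x + t *\<^sub>R v \<in> X" for t
    using assms O' by (auto intro: subspace_add subspace_scale)
  ultimately show ?thesis
    by (auto simp: O'(2) elim: eventually_mono)
qed

lemma eventually_dir_quotient_cong: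
  fixes X :: "'a::lcs set"
  assumes "subspace X" and "openin (top_of_set X) U" and "x \<in> U" and "v \<in> X"
    and "\<And>y. y \<in> U \<Longrightarrow> f y = g y"
  shows "eventually (\<lambda>t. dir_quotient f x v t = dir_quotient g x v t) (at 0)"
  using eventually_line_in_open[OF assms(1-4)]
  by eventually_elim (simp add: dir_quotient_def assms(3,5))

lemma Lim_cong_eventually:
  assumes "eventually (\<lambda>t. f t = g t) F"
  shows "Lim F f = Lim F g"
  unfolding t2_space_class.Lim_def by (simp add: tendsto_cong[OF assms])

text \<open>
  The induction hypothesis gives agreement of the lower derivatives at every point of the open
  set \<open>U\<close>, hence of their difference quotients for small parameters.
\<close>

lemma iter_deriv_cong:
  fixes X :: "'a::lcs set"
  assumes "subspace X" and "openin (top_of_set X) U" and "\<And>y. y \<in> U \<Longrightarrow> f y = g y"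
    and "range v \<subseteq> X" and "x \<in> U"
  shows "iter_deriv f k v x = iter_deriv g k v x"
  using assms(5)
proof (induction k arbitrary: x)
  case 0
  then show ?case by (simp add: assms(3))
next
  case (Suc k)
  have "v k \<in> X"
    using assms(4) by blast
  then show ?case
    unfolding iter_deriv.simps dir_deriv_def
    by (intro Lim_cong_eventually eventually_dir_quotient_cong[OF assms(1,2) Suc.prems _ Suc.IH])
qed

text \<open>
  The maps of a diffeomorphism and of chart transitions are extended to whole types by
  \<open>inv_into\<close>, whose values outside the image depend on the domain it is taken on.  Shrinking a domain
  therefore changes the function, but not on the smaller domain; this lemma absorbs the change.
\<close>

lemma smooth_on_cong:
  fixes X :: "'a::lcs set"
  assumes "smooth_on X U Y f" and "subspace X" and "openin (top_of_set X) U"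
    and fg: "\<And>y. y \<in> U \<Longrightarrow> f y = g y"
  shows "smooth_on X U Y g"
  unfolding smooth_on_def
proof (intro conjI allI ballI impI)
  show "g ` U \<subseteq> Y"
    using assms(1) fg unfolding smooth_on_def by (metis image_cong)
next
  fix k x and v :: "nat \<Rightarrow> 'a"
  assume x: "x \<in> U" and v: "range v \<subseteq> X"
  then obtain w where w: "w \<in> Y" "(dir_quotient (iter_deriv f k v) x (v k) \<longlongrightarrow> w) (at 0)"
    using assms(1) unfolding smooth_on_def by blast
  have "v k \<in> X"
    using v by blast
  then have "eventually (\<lambda>t. dir_quotient (iter_deriv f k v) x (v k) t
      = dir_quotient (iter_deriv g k v) x (v k) t) (at 0)"
    by (rule eventually_dir_quotient_cong[OF assms(2,3) x])
      (rule iter_deriv_cong[OF assms(2,3) fg v])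
  then show "\<exists>w\<in>Y. (dir_quotient (iter_deriv g k v) x (v k) \<longlongrightarrow> w) (at 0)"
    using w tendsto_cong by blast
next
  fix k
  have "continuous_on (U \<times> {v. range v \<subseteq> X}) (\<lambda>(x, v). iter_deriv f k v x)"
    using assms(1) unfolding smooth_on_def by blast
  then show "continuous_on (U \<times> {v. range v \<subseteq> X}) (\<lambda>(x, v). iter_deriv g k v x)"
    by (rule continuous_on_eq) (auto intro!: iter_deriv_cong[OF assms(2,3) fg])
qed

section \<open>Restriction of smooth maps and diffeomorphisms\<close>

text \<open>
  Restricting and comparing maps in charts rests on the charts being homeomorphisms between open
  sets.  For submanifolds this follows from adaptedness of the charts, for products from the factors.
\<close>

definition topological_atlas :: "('p, 'e::lcs) mfd \<Rightarrow> bool" where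
  "topological_atlas M \<longleftrightarrow> (\<forall>c\<in>atlas M. top_chart (mtop M) c)"

lemma manifold_topological_atlas: "manifold M \<Longrightarrow> topological_atlas M"
  unfolding manifold_def topological_atlas_def by blast

lemma top_chart_inj: "top_chart T c \<Longrightarrow> inj_on (cmap c) (cdom c)"
  unfolding top_chart_def homeomorphic_eq_everything_map
  by (metis inf.orderE openin_subset topspace_subtopology inf.commute)

lemma open_image_of_chart:
  assumes "top_chart T c" and "openin T D"
  shows "openin (top_of_set (cmodel c)) (cmap c ` (cdom c \<inter> D))"
proof -
  have h: "homeomorphic_map (subtopology T (cdom c)) (top_of_set (cmap c ` cdom c)) (cmap c)"
    and o: "openin (top_of_set (cmodel c)) (cmap c ` cdom c)"
    using assms(1) unfolding top_chart_def by auto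
  have "openin (subtopology T (cdom c)) (cdom c \<inter> D)"
    using assms(2) by (auto simp: openin_subtopology)
  then have "openin (top_of_set (cmap c ` cdom c)) (cmap c ` (cdom c \<inter> D))"
    using homeomorphic_imp_open_map[OF h] unfolding open_map_def by blast
  then show ?thesis
    using o openin_trans by blast
qed

lemma topological_atlas_openin: "topological_atlas M \<Longrightarrow> c \<in> atlas M \<Longrightarrow> openin (mtop M) (cdom c)"
  unfolding topological_atlas_def top_chart_def by blast

lemma smooth_map_subset:
  assumes "smooth_map M A N f" and "A' \<subseteq> A"
  shows "smooth_map M A' N f"
  unfolding smooth_map_def
proof (intro conjI ballI)
  show "continuous_map (subtopology (mtop M) A') (mtop N) f"
    using assms continuous_map_from_subtopology_mono unfolding smooth_map_def by blast
next
  fix c d assume "c \<in> atlas M" "d \<in> atlas N"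
  then have "smooth_on (cmodel c) (cmap c ` {x \<in> cdom c \<inter> A. f x \<in> cdom d}) (cmodel d)
          (cmap d \<circ> f \<circ> inv_into (cdom c) (cmap c))"
    using assms unfolding smooth_map_def by blast
  then show "smooth_on (cmodel c) (cmap c ` {x \<in> cdom c \<inter> A'. f x \<in> cdom d}) (cmodel d)
          (cmap d \<circ> f \<circ> inv_into (cdom c) (cmap c))"
    by (rule smooth_on_subset) (use assms(2) in blast)
qed

text \<open>
  Openness of \<open>A\<close> and of the chart domains makes the coordinate domains open in the model
  spaces, which \<open>smooth_on_cong\<close> needs.
\<close>

lemma smooth_map_cong:
  assumes "smooth_map M A N f" and "topological_atlas M" and "topological_atlas N"
    and A: "openin (mtop M) A" and fg: "\<And>x. x \<in> A \<Longrightarrow> f x = g x"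
  shows "smooth_map M A N g"
  unfolding smooth_map_def
proof (intro conjI ballI)
  have cont: "continuous_map (subtopology (mtop M) A) (mtop N) f"
    using assms unfolding smooth_map_def by blast
  then show "continuous_map (subtopology (mtop M) A) (mtop N) g"
    by (rule continuous_map_eq) (simp add: fg)
  fix c d assume c: "c \<in> atlas M" and d: "d \<in> atlas N"
  have tc: "top_chart (mtop M) c"
    using c assms(2) unfolding topological_atlas_def by blast
  have s: "smooth_on (cmodel c) (cmap c ` {x \<in> cdom c \<inter> A. f x \<in> cdom d}) (cmodel d)
          (cmap d \<circ> f \<circ> inv_into (cdom c) (cmap c))"
    using c d assms unfolding smooth_map_def by blast
  have "openin (subtopology (mtop M) A) {x \<in> topspace (subtopology (mtop M) A). f x \<in> cdom d}"
    using cont topological_atlas_openin[OF assms(3) d] by (rule openin_continuous_map_preimage)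
  then have "openin (mtop M) {x \<in> topspace (subtopology (mtop M) A). f x \<in> cdom d}"
    using A openin_trans_full by blast
  moreover have "{x \<in> topspace (subtopology (mtop M) A). f x \<in> cdom d} = {x \<in> A. f x \<in> cdom d}"
    using openin_subset[OF A] by auto
  ultimately have "openin (top_of_set (cmodel c)) (cmap c ` (cdom c \<inter> {x \<in> A. f x \<in> cdom d}))"
    using open_image_of_chart[OF tc] by simp
  moreover have e: "cdom c \<inter> {x \<in> A. f x \<in> cdom d} = {x \<in> cdom c \<inter> A. f x \<in> cdom d}"
    by blast
  ultimately have o: "openin (top_of_set (cmodel c)) (cmap c ` {x \<in> cdom c \<inter> A. f x \<in> cdom d})"
    by simp
  have "smooth_on (cmodel c) (cmap c ` {x \<in> cdom c \<inter> A. f x \<in> cdom d}) (cmodel d)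
          (cmap d \<circ> g \<circ> inv_into (cdom c) (cmap c))"
  proof (rule smooth_on_cong[OF s _ o])
    show "subspace (cmodel c)"
      using tc unfolding top_chart_def by blast
    fix y assume "y \<in> cmap c ` {x \<in> cdom c \<inter> A. f x \<in> cdom d}"
    then obtain x where x: "x \<in> cdom c" "x \<in> A" "y = cmap c x"
      by blast
    then show "(cmap d \<circ> f \<circ> inv_into (cdom c) (cmap c)) y
        = (cmap d \<circ> g \<circ> inv_into (cdom c) (cmap c)) y"
      using top_chart_inj[OF tc] fg by simp
  qed
  moreover have "{x \<in> cdom c \<inter> A. f x \<in> cdom d} = {x \<in> cdom c \<inter> A. g x \<in> cdom d}"
    using fg by auto
  ultimately show "smooth_on (cmodel c) (cmap c ` {x \<in> cdom c \<inter> A. g x \<in> cdom d}) (cmodel d)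
          (cmap d \<circ> g \<circ> inv_into (cdom c) (cmap c))"
    by simp
qed

lemma diffeo_inv_into:
  assumes "diffeo M A N B f" and "topological_atlas M" and "topological_atlas N"
  shows "diffeo N B M A (inv_into A f)"
proof -
  have b: "bij_betw f A B" and o: "openin (mtop M) A" "openin (mtop N) B"
    and s: "smooth_map M A N f" "smooth_map N B M (inv_into A f)"
    using assms(1) unfolding diffeo_def by auto
  have "f x = inv_into B (inv_into A f) x" if "x \<in> A" for x
    using b that by (simp add: inv_into_inv_into_eq)
  from smooth_map_cong[OF s(1) assms(2,3) o(1) this]
  have "smooth_map M A N (inv_into B (inv_into A f))" .
  then show ?thesis
    using b o s unfolding diffeo_def by (simp add: bij_betw_inv_into)
qed

lemma diffeo_restrict:
  assumes "diffeo M A N B f" and "topological_atlas M" and "topological_atlas N"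
    and A': "openin (mtop M) A'" "A' \<subseteq> A"
  shows "diffeo M A' N (f ` A') f"
proof -
  have b: "bij_betw f A B" and o: "openin (mtop M) A" "openin (mtop N) B"
    and s: "smooth_map M A N f" "smooth_map N B M (inv_into A f)"
    using assms(1) unfolding diffeo_def by auto
  have inj: "inj_on f A" and im: "f ` A = B"
    using b unfolding bij_betw_def by auto
  have "openin (subtopology (mtop N) B)
      {y \<in> topspace (subtopology (mtop N) B). inv_into A f y \<in> A'}"
    using s(2) A'(1) unfolding smooth_map_def by (blast intro: openin_continuous_map_preimage)
  then have "openin (mtop N) {y \<in> topspace (subtopology (mtop N) B). inv_into A f y \<in> A'}"
    using o(2) openin_trans_full by blast
  moreover have "{y \<in> topspace (subtopology (mtop N) B). inv_into A f y \<in> A'} = f ` A'"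
  proof -
    have "topspace (subtopology (mtop N) B) = f ` A"
      using openin_subset[OF o(2)] im by auto
    then show ?thesis
      using inj A'(2) by auto
  qed
  ultimately have o': "openin (mtop N) (f ` A')"
    by simp
  have "smooth_map N (f ` A') M (inv_into A f)"
    using s(2) by (rule smooth_map_subset) (use A'(2) im in blast)
  then have "smooth_map N (f ` A') M (inv_into A' f)"
  proof (rule smooth_map_cong[OF _ assms(3,2) o'])
    fix y assume "y \<in> f ` A'"
    then obtain x where "x \<in> A'" "y = f x" by blast
    then show "inv_into A f y = inv_into A' f y"
      using inj A'(2) inj_on_subset[OF inj A'(2)] by auto
  qed
  then show ?thesis
    using A' o' inj inj_on_subset[OF inj A'(2)] smooth_map_subset[OF s(1) A'(2)]
    unfolding diffeo_def bij_betw_def by blast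
qed

section \<open>Open pieces of manifolds\<close>

text \<open>
  Restriction to an open subset in a form that fits \<open>submfd\<close>: if \<open>U\<close> is open in the submanifold
  \<open>S\<close>, the charts of \<open>submfd M U\<close> are literally among those of \<open>submfd M S\<close>, so smoothness passes
  to \<open>submfd M U\<close> without any comparison of charts.
\<close>

definition open_piece :: "('p, 'e::lcs) mfd \<Rightarrow> ('p, 'e) mfd \<Rightarrow> bool" where
  "open_piece P' P \<longleftrightarrow> openin (mtop P) (points P') \<and>
     mtop P' = subtopology (mtop P) (points P') \<and> atlas P' \<subseteq> atlas P"

lemma open_piece_openin_iff:
  assumes "open_piece P' P"
  shows "openin (mtop P') A \<longleftrightarrow> openin (mtop P) A \<and> A \<subseteq> points P'"
  using assms openin_open_subtopology unfolding open_piece_def by metis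

lemma open_piece_subtopology:
  assumes "open_piece P' P" and "A \<subseteq> points P'"
  shows "subtopology (mtop P') A = subtopology (mtop P) A"
  using assms unfolding open_piece_def by (metis subtopology_subtopology inf.absorb2)

lemma smooth_map_from_open_piece:
  assumes "open_piece P' P" and "smooth_map P A N f" and "A \<subseteq> points P'"
  shows "smooth_map P' A N f"
  using assms(1,2) open_piece_subtopology[OF assms(1,3)]
  unfolding smooth_map_def open_piece_def by (auto simp: subset_eq)

lemma smooth_map_into_open_piece:
  assumes "open_piece P' P" and "smooth_map M A P f" and "f ` A \<subseteq> points P'"
  shows "smooth_map M A P' f"
proof -
  have "continuous_map (subtopology (mtop M) A) (subtopology (mtop P) (points P')) f"
    using assms(2,3) unfolding smooth_map_def continuous_map_in_subtopology by auto
  then show ?thesis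
    using assms(1,2) unfolding smooth_map_def open_piece_def by (auto simp: subset_eq)
qed

lemma diffeo_from_open_piece:
  assumes "open_piece P' P" and f: "diffeo P A N B f" and A: "A \<subseteq> points P'"
  shows "diffeo P' A N B f"
proof -
  have "inv_into A f ` B \<subseteq> points P'"
    using f A unfolding diffeo_def bij_betw_def by (auto intro: inv_into_into)
  then have "smooth_map N B P' (inv_into A f)"
    using f smooth_map_into_open_piece[OF assms(1)] unfolding diffeo_def by blast
  moreover have "smooth_map P' A N f"
    using f smooth_map_from_open_piece[OF assms(1) _ A] unfolding diffeo_def by blast
  ultimately show ?thesis
    using f A unfolding diffeo_def open_piece_openin_iff[OF assms(1)] by simp
qed

lemma diffeo_into_open_piece:
  assumes "open_piece P' P" and f: "diffeo M A P B f" and B: "B \<subseteq> points P'"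
  shows "diffeo M A P' B f"
proof -
  have "f ` A \<subseteq> points P'"
    using f B unfolding diffeo_def bij_betw_def by blast
  then have "smooth_map M A P' f"
    using f smooth_map_into_open_piece[OF assms(1)] unfolding diffeo_def by blast
  moreover have "smooth_map P' B M (inv_into A f)"
    using f smooth_map_from_open_piece[OF assms(1) _ B] unfolding diffeo_def by blast
  ultimately show ?thesis
    using f B unfolding diffeo_def open_piece_openin_iff[OF assms(1)] by simp
qed

lemma points_prod_mfd [simp]: "points (prod_mfd M N) = points M \<times> points N"
  unfolding prod_mfd_def by simp

text \<open>
  Used for the domain \<open>W \<times> S\<close> of the diffeomorphism onto a neighbourhood of \<open>m\<close> that is part of a
  slice.
\<close>

lemma open_piece_prod_mfd:
  assumes "open_piece P' P"
  shows "open_piece (prod_mfd Q P') (prod_mfd Q P)"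
proof -
  have "mtop (prod_mfd Q P') = subtopology (mtop (prod_mfd Q P)) (points (prod_mfd Q P'))"
    using assms subtopology_Times[of "mtop Q" "mtop P" "points Q" "points P'"]
    unfolding open_piece_def points_prod_mfd by (simp add: prod_mfd_def)
  moreover have "openin (mtop (prod_mfd Q P)) (points (prod_mfd Q P'))"
    using assms unfolding open_piece_def points_prod_mfd
    by (simp add: prod_mfd_def openin_prod_Times_iff)
  moreover have "atlas (prod_mfd Q P') \<subseteq> atlas (prod_mfd Q P)"
    using assms unfolding open_piece_def prod_mfd_def by (simp, blast)
  ultimately show ?thesis
    unfolding open_piece_def by blast
qed

lemma homeomorphic_map_prod:
  assumes "homeomorphic_map X X' f" and "homeomorphic_map Y Y' g"
  shows "homeomorphic_map (prod_topology X Y) (prod_topology X' Y') (\<lambda>(x, y). (f x, g y))"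
proof -
  obtain f' g' where "homeomorphic_maps X X' f f'" "homeomorphic_maps Y Y' g g'"
    using assms unfolding homeomorphic_map_maps by blast
  then show ?thesis
    unfolding homeomorphic_map_maps using homeomorphic_maps_prod by blast
qed

lemma topological_atlas_prod_mfd:
  assumes "topological_atlas M" and "topological_atlas N"
  shows "topological_atlas (prod_mfd M N)"
  unfolding topological_atlas_def
proof
  fix e assume "e \<in> atlas (prod_mfd M N)"
  then obtain c d where c: "c \<in> atlas M" and d: "d \<in> atlas N"
    and e: "e = \<lparr>cdom = cdom c \<times> cdom d, cmap = map_prod (cmap c) (cmap d),
               cmodel = cmodel c \<times> cmodel d\<rparr>"
    unfolding prod_mfd_def by auto
  have tc: "top_chart (mtop M) c" and td: "top_chart (mtop N) d"
    using assms c d unfolding topological_atlas_def by auto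
  have ts: "top_of_set (A \<times> B) = prod_topology (top_of_set A) (top_of_set B)"
    for A :: "'b set" and B :: "'d set"
    by (simp flip: subtopology_Times)
  have im: "cmap e ` cdom e = (cmap c ` cdom c) \<times> (cmap d ` cdom d)"
    unfolding e by auto
  have "homeomorphic_map (prod_topology (subtopology (mtop M) (cdom c)) (subtopology (mtop N) (cdom d)))
      (prod_topology (top_of_set (cmap c ` cdom c)) (top_of_set (cmap d ` cdom d)))
      (\<lambda>(x, y). (cmap c x, cmap d y))"
    by (rule homeomorphic_map_prod) (use tc td in \<open>auto simp: top_chart_def\<close>)
  moreover have "(\<lambda>(x, y). (cmap c x, cmap d y)) = cmap e"
    unfolding e by auto
  ultimately have "homeomorphic_map (subtopology (mtop (prod_mfd M N)) (cdom e))
      (top_of_set (cmap e ` cdom e)) (cmap e)"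
    unfolding im ts unfolding e prod_mfd_def by (simp add: subtopology_Times)
  moreover have "openin (mtop (prod_mfd M N)) (cdom e)"
    using tc td unfolding e prod_mfd_def top_chart_def by (simp add: openin_prod_Times_iff)
  moreover have "subspace (cmodel e)"
    using tc td unfolding e top_chart_def by (simp add: subspace_Times)
  moreover have "openin (top_of_set (cmodel e)) (cmap e ` cdom e)"
  proof -
    have "openin (top_of_set (cmodel c \<times> cmodel d)) ((cmap c ` cdom c) \<times> (cmap d ` cdom d))"
      unfolding ts openin_prod_Times_iff using tc td unfolding top_chart_def by blast
    then show ?thesis
      unfolding im unfolding e by simp
  qed
  ultimately show "top_chart (mtop (prod_mfd M N)) e"
    unfolding top_chart_def by blast
qed

text \<open>
  An adapted chart maps \<open>cdom c \<inter> S\<close> onto the trace on \<open>F\<close> of an open subset of the model space.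
\<close>

lemma topological_atlas_submfd: "topological_atlas (submfd M S)"
  unfolding topological_atlas_def
proof
  fix e assume "e \<in> atlas (submfd M S)"
  then obtain c F where e: "e = \<lparr>cdom = cdom c \<inter> S, cmap = cmap c, cmodel = F\<rparr>"
    and c: "adapted_chart M S c F"
    unfolding submfd_def by auto
  have tc: "top_chart (mtop M) c" and F: "subspace F" "closedin (top_of_set (cmodel c)) F"
    and im: "cmap c ` (cdom c \<inter> S) = cmap c ` cdom c \<inter> F"
    using c unfolding adapted_chart_def maximal_atlas_def by auto
  have o: "openin (mtop M) (cdom c)" "openin (top_of_set (cmodel c)) (cmap c ` cdom c)"
    and h: "homeomorphic_map (subtopology (mtop M) (cdom c)) (top_of_set (cmap c ` cdom c)) (cmap c)"
    using tc unfolding top_chart_def by auto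
  have FX: "F \<subseteq> cmodel c"
    using F(2) closedin_subset by fastforce
  have "openin (top_of_set F) (cmap c ` cdom c \<inter> F)"
    using o(2) FX by (metis inf_commute openin_subtopology_Int2 subtopology_subtopology inf.absorb2)
  moreover have "homeomorphic_map (subtopology (subtopology (mtop M) S) (cdom c \<inter> S))
      (top_of_set (cmap c ` (cdom c \<inter> S))) (cmap c)"
  proof -
    have "homeomorphic_map (subtopology (subtopology (mtop M) (cdom c)) (cdom c \<inter> S))
      (subtopology (top_of_set (cmap c ` cdom c)) (cmap c ` (cdom c \<inter> S))) (cmap c)"
      by (rule homeomorphic_map_subtopologies[OF h])
        (use openin_subset[OF o(1)] top_chart_inj[OF tc] in \<open>auto dest: inj_onD\<close>)
    moreover have "cdom c \<inter> (cdom c \<inter> S) = S \<inter> (cdom c \<inter> S)"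
      by blast
    moreover have "cmap c ` cdom c \<inter> cmap c ` (cdom c \<inter> S) = cmap c ` (cdom c \<inter> S)"
      by blast
    ultimately show ?thesis
      by (simp add: subtopology_subtopology)
  qed
  moreover have "openin (subtopology (mtop M) S) (cdom c \<inter> S)"
    using o(1) by (auto simp: openin_subtopology)
  ultimately show "top_chart (mtop (submfd M S)) e"
    unfolding top_chart_def e submfd_def using F im by simp
qed

lemma topological_atlas_lcs_mfd:
  assumes "subspace X"
  shows "topological_atlas (lcs_mfd X)"
proof -
  have "homeomorphic_map (subtopology (top_of_set X) X) (top_of_set X) id"
    by (simp add: subtopology_subtopology homeomorphic_map_id)
  then show ?thesis
    using assms unfolding topological_atlas_def lcs_mfd_def top_chart_def by simp
qed

section \<open>Open subsets of submanifolds\<close>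

definition restrict_chart :: "('p, 'e) chart \<Rightarrow> 'p set \<Rightarrow> ('p, 'e) chart" where
  "restrict_chart c D = c\<lparr>cdom := cdom c \<inter> D\<rparr>"

lemma restrict_chart_simps [simp]:
  "cdom (restrict_chart c D) = cdom c \<inter> D"
  "cmap (restrict_chart c D) = cmap c"
  "cmodel (restrict_chart c D) = cmodel c"
  unfolding restrict_chart_def by simp_all

lemma top_chart_restrict:
  assumes "top_chart T c" and D: "openin T D"
  shows "top_chart T (restrict_chart c D)"
proof -
  have o: "openin T (cdom c)" 
    and h: "homeomorphic_map (subtopology T (cdom c)) (top_of_set (cmap c ` cdom c)) (cmap c)"
    using assms(1) unfolding top_chart_def by auto
  have "homeomorphic_map (subtopology (subtopology T (cdom c)) (cdom c \<inter> D))
      (subtopology (top_of_set (cmap c ` cdom c)) (cmap c ` (cdom c \<inter> D))) (cmap c)"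
    by (rule homeomorphic_map_subtopologies[OF h])
      (use openin_subset[OF o] top_chart_inj[OF assms(1)] in \<open>auto dest: inj_onD\<close>)
  moreover have "cmap c ` cdom c \<inter> cmap c ` (cdom c \<inter> D) = cmap c ` (cdom c \<inter> D)"
    by blast
  moreover have "cdom c \<inter> (cdom c \<inter> D) = cdom c \<inter> D"
    by blast
  ultimately have "homeomorphic_map (subtopology T (cdom c \<inter> D))
      (top_of_set (cmap c ` (cdom c \<inter> D))) (cmap c)"
    by (simp add: subtopology_subtopology)
  then show ?thesis
    using assms open_image_of_chart[OF assms] unfolding top_chart_def by (simp add: openin_Int)
qed

lemma top_chart_open_piece:
  assumes "open_piece P' P" and "top_chart (mtop P) c" and "cdom c \<subseteq> points P'"
  shows "top_chart (mtop P') c"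
  using assms unfolding top_chart_def open_piece_openin_iff[OF assms(1)]
  by (simp add: open_piece_subtopology)

lemma smooth_transition_restrict_left:
  assumes "smooth_transition c d" and tc: "top_chart T c" and "openin T (cdom d)" and "openin T D"
  shows "smooth_transition (restrict_chart c D) d"
proof -
  have "openin (top_of_set (cmodel c)) (cmap c ` (cdom c \<inter> (D \<inter> cdom d)))"
    by (rule open_image_of_chart[OF tc]) (use assms in blast)
  then have o: "openin (top_of_set (cmodel c)) (cmap c ` (cdom c \<inter> D \<inter> cdom d))"
    by (simp add: Int_assoc)
  have "smooth_on (cmodel c) (cmap c ` (cdom c \<inter> D \<inter> cdom d)) (cmodel d)
      (cmap d \<circ> inv_into (cdom c) (cmap c))"
    using assms(1) unfolding smooth_transition_def by (rule smooth_on_subset) blast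
  then have "smooth_on (cmodel c) (cmap c ` (cdom c \<inter> D \<inter> cdom d)) (cmodel d)
      (cmap d \<circ> inv_into (cdom c \<inter> D) (cmap c))"
  proof (rule smooth_on_cong[OF _ _ o])
    show "subspace (cmodel c)"
      using tc unfolding top_chart_def by blast
    have i: "inj_on (cmap c) (cdom c)" "inj_on (cmap c) (cdom c \<inter> D)"
      using top_chart_inj[OF tc] by (auto intro: inj_on_subset)
    fix y assume "y \<in> cmap c ` (cdom c \<inter> D \<inter> cdom d)"
    then obtain x where "x \<in> cdom c" "x \<in> D" "y = cmap c x"
      by blast
    then show "(cmap d \<circ> inv_into (cdom c) (cmap c)) y
        = (cmap d \<circ> inv_into (cdom c \<inter> D) (cmap c)) y"
      using i by (simp add: inv_into_f_f)
  qed
  then show ?thesis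
    unfolding smooth_transition_def by simp
qed

lemma smooth_transition_restrict_right:
  assumes "smooth_transition d c"
  shows "smooth_transition d (restrict_chart c D)"
  using assms unfolding smooth_transition_def restrict_chart_simps
  by (rule smooth_on_subset) blast

lemma restrict_chart_maximal_atlas:
  assumes "open_piece P' P" and "topological_atlas P" and c: "c \<in> maximal_atlas P"
    and D: "openin (mtop P) D" "D \<subseteq> points P'"
  shows "restrict_chart c D \<in> maximal_atlas P'"
proof -
  have tc: "top_chart (mtop P) c"
    using c unfolding maximal_atlas_def by blast
  have "top_chart (mtop P') (restrict_chart c D)"
    by (rule top_chart_open_piece[OF assms(1) top_chart_restrict[OF tc D(1)]]) (use D in auto)
  moreover have "smooth_transition (restrict_chart c D) d \<and> smooth_transition d (restrict_chart c D)"
    if "d \<in> atlas P'" for d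
  proof -
    have d: "d \<in> atlas P"
      using that assms(1) unfolding open_piece_def by blast
    then have "smooth_transition c d" "smooth_transition d c"
      using c unfolding maximal_atlas_def by auto
    then show ?thesis
      using smooth_transition_restrict_left[OF _ tc topological_atlas_openin[OF assms(2) d] D(1)]
        smooth_transition_restrict_right by blast
  qed
  ultimately show ?thesis
    unfolding maximal_atlas_def by blast
qed

text \<open>
  The set cut out by the chart may be changed from \<open>T\<close> to \<open>T'\<close> because adaptedness of the restricted
  chart only concerns points of \<open>D\<close>.  Both directions are used: from a submanifold to an open part of
  it, and, with \<open>T\<close> open in \<open>T'\<close>, from the part back to the whole.
\<close>

lemma adapted_chart_restrict:
  assumes "open_piece P' P" and "topological_atlas P" and c: "adapted_chart P T c F"
    and D: "openin (mtop P) D" "D \<subseteq> points P'" and TT': "T \<inter> D = T' \<inter> D"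
  shows "adapted_chart P' T' (restrict_chart c D) F"
proof -
  have c': "c \<in> maximal_atlas P" "subspace F" "closedin (top_of_set (cmodel c)) F"
    and im: "cmap c ` (cdom c \<inter> T) = cmap c ` cdom c \<inter> F"
    using c unfolding adapted_chart_def by auto
  have inj: "inj_on (cmap c) (cdom c)"
    using c'(1) top_chart_inj unfolding maximal_atlas_def by blast
  have "cmap c ` (cdom c \<inter> D \<inter> T') = cmap c ` (cdom c \<inter> T \<inter> (cdom c \<inter> D))"
    using TT' by (intro arg_cong[of _ _ "\<lambda>A. cmap c ` A"]) blast
  also have "\<dots> = cmap c ` (cdom c \<inter> T) \<inter> cmap c ` (cdom c \<inter> D)"
    by (rule inj_on_image_Int[OF inj]) auto
  also have "\<dots> = cmap c ` (cdom c \<inter> D) \<inter> F"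
    unfolding im by blast
  finally show ?thesis
    using c' restrict_chart_maximal_atlas[OF assms(1,2) c'(1) D] unfolding adapted_chart_def by simp
qed

lemma open_piece_refl: "open_piece M M"
  unfolding open_piece_def by simp

lemma submanifold_open_subset:
  assumes "open_piece P' P" and "topological_atlas P" and T: "submanifold P T"
    and D: "openin (mtop P) D" "D \<subseteq> points P'"
  shows "submanifold P' (T \<inter> D)"
  unfolding submanifold_def
proof (intro conjI ballI)
  show "T \<inter> D \<subseteq> points P'"
    using D(2) by blast
  fix s assume s: "s \<in> T \<inter> D"
  then obtain c F where c: "s \<in> cdom c" "adapted_chart P T c F"
    using T unfolding submanifold_def by blast
  have "adapted_chart P' (T \<inter> D) (restrict_chart c D) F"
    by (rule adapted_chart_restrict[OF assms(1,2) c(2) D]) blast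
  moreover have "s \<in> cdom (restrict_chart c D)"
    using c(1) s by simp
  ultimately show "\<exists>c F. s \<in> cdom c \<and> adapted_chart P' (T \<inter> D) c F"
    by blast
qed

lemma points_submfd: "points (submfd M S) = points M \<inter> S"
  unfolding submfd_def by simp

text \<open>
  Write \<open>U = D \<inter> S\<close> with \<open>D\<close> open in \<open>M\<close>.  A chart \<open>c\<close> adapted to \<open>U\<close> need not be adapted to \<open>S\<close>,
  since \<open>S\<close> may return to \<open>cdom c\<close> outside \<open>U\<close>; but its restriction to \<open>D\<close> is, and it induces on \<open>S\<close>
  the same chart, with domain \<open>cdom c \<inter> U\<close>, as \<open>c\<close> induces on \<open>U\<close>.
\<close>

lemma open_piece_submfd:
  assumes M: "topological_atlas M" and U: "openin (mtop (submfd M S)) U"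
  shows "open_piece (submfd M U) (submfd M S)"
proof -
  obtain D where D: "openin (mtop M) D" "U = D \<inter> S"
    using U by (auto simp: submfd_def openin_subtopology)
  have pU: "points (submfd M U) = U"
    using openin_subset[OF D(1)] D(2) by (auto simp: points_submfd)
  have "atlas (submfd M U) \<subseteq> atlas (submfd M S)"
  proof
    fix e assume "e \<in> atlas (submfd M U)"
    then obtain c F where e: "e = \<lparr>cdom = cdom c \<inter> U, cmap = cmap c, cmodel = F\<rparr>"
      and c: "adapted_chart M U c F"
      unfolding submfd_def by auto
    have "adapted_chart M S (restrict_chart c D) F"
      by (rule adapted_chart_restrict[OF open_piece_refl M c D(1) openin_subset[OF D(1)]])
        (use D(2) in blast)
    moreover have "e = \<lparr>cdom = cdom (restrict_chart c D) \<inter> S, cmap = cmap (restrict_chart c D),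
        cmodel = F\<rparr>"
      using e D(2) by (simp add: Int_assoc)
    ultimately show "e \<in> atlas (submfd M S)"
      unfolding submfd_def by (simp, blast)
  qed
  moreover have "mtop (submfd M U) = subtopology (mtop (submfd M S)) U"
  proof -
    have "S \<inter> U = U"
      using D(2) by blast
    then show ?thesis
      by (simp add: submfd_def subtopology_subtopology)
  qed
  ultimately show ?thesis
    using U unfolding open_piece_def pU by simp
qed

lemma submanifold_of_open_subset:
  assumes "topological_atlas M" and S: "submanifold M S" and U: "openin (mtop (submfd M S)) U"
  shows "submanifold M U"
proof -
  obtain D where D: "openin (mtop M) D" "U = D \<inter> S"
    using U by (auto simp: submfd_def openin_subtopology)
  then show ?thesis
    using submanifold_open_subset[OF open_piece_refl assms(1) S D(1)] openin_subset[OF D(1)]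
    by (simp add: Int_commute)
qed

section \<open>Shrinking a slice\<close>

text \<open>
  All slice axioms but the linear model are inherited by an invariant open neighbourhood \<open>U\<close> of \<open>m\<close>
  in \<open>S\<close>: the separation condition becomes weaker, the orbit-type condition is cut down to an open
  subset, and the diffeomorphism defined on \<open>W \<times> S\<close> is restricted to \<open>W \<times> U\<close>.  Restricting the
  linear model of \<open>S\<close> would keep its representation space, which may have another type than the one
  of a normal form; a model of \<open>U\<close> is therefore an assumption, to be met by the inverse of a normal
  form chart.
\<close>

lemma slice_open_subset:
  fixes M :: "('p, 'e::lcs) mfd" and K :: "('g, 'l::lcs) lie" and X :: "'x::lcs set"
  assumes K: "lie_group K" and M: "manifold M" and act: "group_action K (points M) \<phi>"
    and S: "slice TYPE('z::lcs) K M \<phi> m S"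
    and U: "openin (mtop (submfd M S)) U" and mU: "m \<in> U"
    and inv: "\<forall>h\<in>stabilizer K \<phi> m. \<phi> h ` U \<subseteq> U"
    and lin: "linear_action (isotropy K \<phi> m) X A" "0 \<in> D" "invariant_set (isotropy K \<phi> m) A D"
      "diffeo (lcs_mfd X) D (submfd M U) U \<iota>" "equivariant_on (isotropy K \<phi> m) A \<phi> D \<iota>" "\<iota> 0 = m"
  shows "slice TYPE('x) K M \<phi> m U"
proof -
  let ?H = "stabilizer K \<phi> m"
  have tM: "topological_atlas M"
    using M by (rule manifold_topological_atlas)
  have piece: "open_piece (submfd M U) (submfd M S)"
    using tM U by (rule open_piece_submfd)
  have US: "U \<subseteq> S" and UM: "U \<subseteq> points M"
    using openin_subset[OF U] by (auto simp: points_submfd)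
  have pU: "points (submfd M U) = U"
    using UM by (auto simp: points_submfd)
  have subm: "submanifold M S" and sl2: "\<forall>g\<in>carrier K. \<phi> g ` S \<inter> S \<noteq> {} \<longrightarrow> g \<in> ?H"
    and lie: "lie_subgroup K ?H"
    using S unfolding slice_def by - (elim conjE, assumption)+
  obtain Q W \<sigma> B where Q: "principal_quotient K ?H Q"
    and W: "openin (mtop Q) W" "\<one>\<^bsub>K\<^esub> <#\<^bsub>K\<^esub> ?H \<in> W"
    and \<sigma>: "smooth_map Q W (gmfd K) \<sigma>" "\<forall>w\<in>W. \<sigma> w <#\<^bsub>K\<^esub> ?H = w" and mB: "m \<in> B"
    and tube: "diffeo (prod_mfd Q (submfd M S)) (W \<times> S) M B (\<lambda>(w, s). \<phi> (\<sigma> w) s)"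
    using S[unfolded slice_def, THEN conjunct2, THEN conjunct2, THEN conjunct2, THEN conjunct2,
        THEN conjunct2, THEN conjunct1] by (elim exE conjE) (rule that)
  let ?F = "\<lambda>(w, s). \<phi> (\<sigma> w) s"
  have tQ: "topological_atlas Q"
    using Q manifold_topological_atlas unfolding principal_quotient_def by blast
  have "diffeo (prod_mfd Q (submfd M S)) (W \<times> U) M (?F ` (W \<times> U)) ?F"
  proof (rule diffeo_restrict[OF tube _ tM])
    show "topological_atlas (prod_mfd Q (submfd M S))"
      using tQ topological_atlas_submfd by (rule topological_atlas_prod_mfd)
    show "openin (mtop (prod_mfd Q (submfd M S))) (W \<times> U)"
      using W(1) U unfolding prod_mfd_def by (simp add: openin_prod_Times_iff)
  qed (use US in blast)
  then have tubeU: "diffeo (prod_mfd Q (submfd M U)) (W \<times> U) M (?F ` (W \<times> U)) ?F"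
    by (rule diffeo_from_open_piece[OF open_piece_prod_mfd[OF piece]])
      (use openin_subset[OF W(1)] pU in auto)
  \<comment> \<open>A preimage \<open>(w, s)\<close> of \<open>m\<close> in \<open>W \<times> S\<close> has \<open>\<sigma> w\<close> moving a point of \<open>S\<close> into \<open>S\<close>, so \<open>\<sigma> w\<close> fixes \<open>m\<close>
    and \<open>s = m\<close>, which lies in \<open>U\<close>.\<close>
  have "m \<in> ?F ` (W \<times> U)"
  proof -
    have "m \<in> ?F ` (W \<times> S)"
      using mB tube unfolding diffeo_def bij_betw_def by metis
    then obtain w s where w: "w \<in> W" and s: "s \<in> S" "\<phi> (\<sigma> w) s = m"
      by auto
    have "\<sigma> w \<in> carrier K"
    proof -
      have "continuous_map (subtopology (mtop Q) W) (gtop K) \<sigma>"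
        using \<sigma>(1) unfolding smooth_map_def by blast
      moreover have "points (gmfd K) = carrier K"
        using K unfolding lie_group_def by blast
      ultimately show ?thesis
        using w openin_subset[OF W(1)] continuous_map_image_subset_topspace by fastforce
    qed
    moreover have "m \<in> S"
      using mU US by blast
    ultimately have "\<sigma> w \<in> ?H"
      using sl2 s by blast
    then have "\<phi> (\<sigma> w) m = m"
      by (simp add: stabilizer_def)
    then have "s = m"
      using group_action.inj_prop[OF act \<open>\<sigma> w \<in> carrier K\<close>] s subm mU UM
      unfolding submanifold_def by (auto dest!: inj_onD)
    then show ?thesis
      using w s(2) mU by force
  qed
  let ?T = "{s \<in> S. \<exists>g\<in>carrier K.
    stabilizer K \<phi> s = (\<lambda>h. g \<otimes>\<^bsub>K\<^esub> h \<otimes>\<^bsub>K\<^esub> inv\<^bsub>K\<^esub> g) ` ?H}"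
  let ?TU = "{s \<in> U. \<exists>g\<in>carrier K.
    stabilizer K \<phi> s = (\<lambda>h. g \<otimes>\<^bsub>K\<^esub> h \<otimes>\<^bsub>K\<^esub> inv\<^bsub>K\<^esub> g) ` ?H}"
  have T: "closedin (mtop (submfd M S)) ?T" "submanifold (submfd M S) ?T"
    using S unfolding slice_def Let_def by - (elim conjE, assumption)+
  have TU: "?TU = ?T \<inter> U"
    using US by blast
  have "closedin (mtop (submfd M U)) ?TU"
  proof -
    have "mtop (submfd M U) = subtopology (mtop (submfd M S)) U"
      using piece unfolding open_piece_def pU by blast
    then show ?thesis
      unfolding TU using T(1) by (auto simp only: closedin_subtopology)
  qed
  moreover have "submanifold (submfd M U) ?TU"
    unfolding TU
    by (rule submanifold_open_subset[OF piece topological_atlas_submfd T(2) U]) (simp add: pU)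
  moreover have "submanifold M U"
    using tM subm U by (rule submanifold_of_open_subset)
  moreover have "\<forall>g\<in>carrier K. \<phi> g ` U \<inter> U \<noteq> {} \<longrightarrow> g \<in> ?H"
    using sl2 US by blast
  moreover have "\<exists>Q W \<sigma> B. principal_quotient K ?H Q \<and> openin (mtop Q) W \<and>
      \<one>\<^bsub>K\<^esub> <#\<^bsub>K\<^esub> ?H \<in> W \<and> smooth_map Q W (gmfd K) \<sigma> \<and> (\<forall>w\<in>W. \<sigma> w <#\<^bsub>K\<^esub> ?H = w) \<and>
      m \<in> B \<and> diffeo (prod_mfd Q (submfd M U)) (W \<times> U) M B (\<lambda>(w, s). \<phi> (\<sigma> w) s)"
    by (intro exI conjI) (fact Q W \<sigma> tubeU \<open>m \<in> ?F ` (W \<times> U)\<close>)+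
  moreover have "\<exists>(X :: 'x set) A D \<iota>. linear_action (isotropy K \<phi> m) X A \<and>
      0 \<in> D \<and> invariant_set (isotropy K \<phi> m) A D \<and> diffeo (lcs_mfd X) D (submfd M U) U \<iota> \<and>
      equivariant_on (isotropy K \<phi> m) A \<phi> D \<iota> \<and> \<iota> 0 = m"
    by (intro exI conjI) (fact lin)+
  ultimately show ?thesis
    unfolding slice_def Let_def using mU inv lie by (intro conjI)
qed

section \<open>Isotropy groups\<close>

lemma isotropy_simps [simp]:
  "carrier (isotropy G \<phi> x) = stabilizer G \<phi> x"
  "gmfd (isotropy G \<phi> x) = submfd (gmfd G) (stabilizer G \<phi> x)"
  "mult (isotropy G \<phi> x) = mult G"
  "one (isotropy G \<phi> x) = one G"
  unfolding isotropy_def lie_restrict_def by simp_all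

text \<open>
  The fibre of the proper map \<open>(g, y) \<mapsto> (g y, y)\<close> over \<open>(x, x)\<close> is the product of the stabilizer of
  \<open>x\<close> with \<open>{x}\<close>.
\<close>

lemma compact_isotropy:
  assumes G: "lie_group G" and proper: "proper_action G M \<phi>" and x: "x \<in> points M"
  shows "compact_space (gtop (isotropy G \<phi> x))"
proof -
  let ?f = "\<lambda>(g, x). (\<phi> g x, x)"
  have "compactin (prod_topology (gtop G) (mtop M))
      {p \<in> topspace (prod_topology (gtop G) (mtop M)). ?f p \<in> {(x, x)}}"
    by (rule compactin_proper_map_preimage[OF proper[unfolded proper_action_def]]) (simp add: x)
  moreover have "{p \<in> topspace (prod_topology (gtop G) (mtop M)). ?f p \<in> {(x, x)}}
      = stabilizer G \<phi> x \<times> {x}"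
    using G x unfolding lie_group_def by (auto simp: stabilizer_def)
  ultimately have "compactin (prod_topology (gtop G) (mtop M)) (stabilizer G \<phi> x \<times> {x})"
    by simp
  then have "compactin (gtop G) (fst ` (stabilizer G \<phi> x \<times> {x}))"
    using continuous_map_fst by (rule image_compactin)
  then show ?thesis
    by (simp add: submfd_def compact_space_subtopology)
qed

lemma group_action_subgroup:
  assumes act: "group_action G E \<phi>" and H: "subgroup H G"
    and K: "group K" "carrier K = H" "mult K = mult G"
  shows "group_action K E \<phi>"
proof -
  have hom: "group_hom G (BijGroup E) \<phi>"
    using act unfolding group_action_def .
  then have "\<phi> \<in> hom K (BijGroup E)"
    using K(2,3) subgroup.subset[OF H] unfolding group_hom_def group_hom_axioms_def hom_def
    by auto
  then show ?thesis
    using hom K(1) unfolding group_action_def group_hom_def group_hom_axioms_def by blast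
qed

section \<open>Maps between associated bundles\<close>

text \<open>
  An action in elementwise form.  Unlike for \<open>group_action\<close>, the maps \<open>A h\<close> need not be extensional
  on \<open>U\<close>, so that the property passes to invariant subsets.
\<close>

definition acts_on :: "('g, 'l) lie \<Rightarrow> 'g set \<Rightarrow> ('g \<Rightarrow> 'x \<Rightarrow> 'x) \<Rightarrow> 'x set \<Rightarrow> bool" where
  "acts_on K H A U \<longleftrightarrow> (\<forall>h\<in>H. \<forall>x\<in>U. A h x \<in> U) \<and> (\<forall>x\<in>U. A \<one>\<^bsub>K\<^esub> x = x) \<and>
     (\<forall>h\<in>H. \<forall>h'\<in>H. \<forall>x\<in>U. A (h \<otimes>\<^bsub>K\<^esub> h') x = A h (A h' x))"

lemma acts_on_invariant_subset:
  assumes "group_action H E A" and "U \<subseteq> E" and "invariant_set H A U"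
    and "mult H = mult K" and "one H = one K"
  shows "acts_on K (carrier H) A U"
proof -
  interpret group_action H E A by fact
  have "A \<one>\<^bsub>H\<^esub> x = x" if "x \<in> U" for x
    using id_eq_one assms(2) that by (metis restrict_apply' subsetD)
  moreover have "A (h \<otimes>\<^bsub>H\<^esub> h') x = A h (A h' x)"
    if "h \<in> carrier H" "h' \<in> carrier H" "x \<in> U" for h h' x
    using that assms(2) composition_rule by blast
  ultimately show ?thesis
    using assms(3-5) unfolding acts_on_def invariant_set_def by (simp add: image_subset_iff)
qed

text \<open>
  With \<open>g = g' h\<close> and \<open>x' = h x\<close>, symmetry is witnessed by the inverse of \<open>h\<close>, and transitivity by
  the product of the two witnesses, the second one on the left.
\<close>

lemma equiv_assoc_rel:
  assumes K: "group K" and H: "subgroup H K" and A: "acts_on K H A U"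
  shows "equiv (carrier K \<times> U) (assoc_rel K H A U)"
proof (rule equivI)
  interpret group K by fact
  interpret H: subgroup H K by fact
  show "assoc_rel K H A U \<subseteq> (carrier K \<times> U) \<times> (carrier K \<times> U)"
    unfolding assoc_rel_def by auto
  show "refl_on (carrier K \<times> U) (assoc_rel K H A U)"
    using A H.one_closed unfolding refl_on_def assoc_rel_def acts_on_def by force
  show "sym (assoc_rel K H A U)"
  proof (rule symI)
    fix p q assume "(p, q) \<in> assoc_rel K H A U"
    then obtain g x g' h where p: "p = (g, x)" "q = (g', A h x)" "g = g' \<otimes>\<^bsub>K\<^esub> h"
      and in_: "g \<in> carrier K" "x \<in> U" "g' \<in> carrier K" "A h x \<in> U" "h \<in> H"
      unfolding assoc_rel_def by auto
    have "g' = g \<otimes>\<^bsub>K\<^esub> inv\<^bsub>K\<^esub> h"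
      using in_ p(3) H.subset by (simp add: m_assoc subset_iff)
    moreover have "A (inv\<^bsub>K\<^esub> h) (A h x) = x"
    proof -
      have "A (inv\<^bsub>K\<^esub> h \<otimes>\<^bsub>K\<^esub> h) x = A (inv\<^bsub>K\<^esub> h) (A h x)"
        using A in_ H.m_inv_closed unfolding acts_on_def by blast
      moreover have "inv\<^bsub>K\<^esub> h \<otimes>\<^bsub>K\<^esub> h = \<one>\<^bsub>K\<^esub>"
        using in_ H.mem_carrier by simp
      ultimately show ?thesis
        using A in_ unfolding acts_on_def by simp
    qed
    ultimately show "(q, p) \<in> assoc_rel K H A U"
      unfolding assoc_rel_def p(1,2) using in_ H.m_inv_closed by force
  qed
  show "trans (assoc_rel K H A U)"
  proof (rule transI)
    fix p q r assume "(p, q) \<in> assoc_rel K H A U" "(q, r) \<in> assoc_rel K H A U"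
    then obtain g x g' h g'' h' where p: "p = (g, x)" "q = (g', A h x)" "g = g' \<otimes>\<^bsub>K\<^esub> h"
      and q: "r = (g'', A h' (A h x))" "g' = g'' \<otimes>\<^bsub>K\<^esub> h'"
      and in_: "g \<in> carrier K" "x \<in> U" "g'' \<in> carrier K" "A h' (A h x) \<in> U" "h \<in> H" "h' \<in> H"
      unfolding assoc_rel_def by auto
    have "g = g'' \<otimes>\<^bsub>K\<^esub> (h' \<otimes>\<^bsub>K\<^esub> h)"
      using in_ p(3) q(2) H.subset by (simp add: m_assoc subset_iff)
    moreover have "A (h' \<otimes>\<^bsub>K\<^esub> h) x = A h' (A h x)"
      using A in_ unfolding acts_on_def by simp
    ultimately show "(p, r) \<in> assoc_rel K H A U"
      unfolding assoc_rel_def p(1) q(1) using in_ H.m_closed by force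
  qed
qed

lemma descend_eq:
  assumes "p \<in> C" and "\<And>q. q \<in> C \<Longrightarrow> F q = F p"
  shows "descend F C = F p"
proof -
  have "F ` C = {F p}"
    using assms by blast
  then show ?thesis
    unfolding descend_def by simp
qed

lemma descend_assoc_class:
  assumes "group K" and "subgroup H K" and "acts_on K H A U" and p: "g \<in> carrier K" "x \<in> U"
    and F: "\<And>g h x. g \<in> carrier K \<Longrightarrow> h \<in> H \<Longrightarrow> x \<in> U \<Longrightarrow> F (g \<otimes>\<^bsub>K\<^esub> h, x) = F (g, A h x)"
  shows "descend F (assoc_class K H A U (g, x)) = F (g, x)"
proof (rule descend_eq)
  show "(g, x) \<in> assoc_class K H A U (g, x)"
    using equiv_class_self[OF equiv_assoc_rel[OF assms(1-3)]] p unfolding assoc_class_def by blast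
  fix q assume "q \<in> assoc_class K H A U (g, x)"
  then show "F q = F (g, x)"
    using F unfolding assoc_class_def assoc_rel_def by force
qed

lemma assoc_map_assoc_class:
  assumes "group K" and "subgroup H K" and "acts_on K H A U" and B: "acts_on K H B V"
    and p: "g \<in> carrier K" "x \<in> U"
    and k: "\<And>x. x \<in> U \<Longrightarrow> k x \<in> V" "\<And>h x. h \<in> H \<Longrightarrow> x \<in> U \<Longrightarrow> k (A h x) = B h (k x)"
  shows "assoc_map K H B V k (assoc_class K H A U (g, x)) = assoc_class K H B V (g, k x)"
proof -
  have "assoc_class K H B V (g \<otimes>\<^bsub>K\<^esub> h, k x) = assoc_class K H B V (g, k (A h x))"
    if "g \<in> carrier K" "h \<in> H" "x \<in> U" for g h x
    unfolding assoc_class_def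
  proof (rule equiv_class_eq[OF equiv_assoc_rel[OF assms(1,2) B]])
    show "((g \<otimes>\<^bsub>K\<^esub> h, k x), (g, k (A h x))) \<in> assoc_rel K H B V"
      using that k B subgroup.subset[OF assms(2)] group.is_monoid[OF assms(1)]
      unfolding assoc_rel_def acts_on_def by (auto intro: monoid.m_closed)
  qed
  then show ?thesis
    unfolding assoc_map_def by (subst descend_assoc_class[OF assms(1-3) p]) auto
qed

lemma tube_map_assoc_class:
  assumes "group K" and "subgroup H K" and "acts_on K H A U" and \<psi>: "acts_on K (carrier K) \<psi> P"
    and p: "g \<in> carrier K" "x \<in> U"
    and k: "\<And>x. x \<in> U \<Longrightarrow> k x \<in> P" "\<And>h x. h \<in> H \<Longrightarrow> x \<in> U \<Longrightarrow> k (A h x) = \<psi> h (k x)"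
  shows "tube_map \<psi> k (assoc_class K H A U (g, x)) = \<psi> g (k x)"
proof -
  have "\<psi> (g \<otimes>\<^bsub>K\<^esub> h) (k x) = \<psi> g (k (A h x))" if "g \<in> carrier K" "h \<in> H" "x \<in> U" for g h x
    using that k \<psi> subgroup.subset[OF assms(2)] unfolding acts_on_def by auto
  then show ?thesis
    unfolding tube_map_def by (subst descend_assoc_class[OF assms(1-3) p]) auto
qed

text \<open>
  The normal form map takes values in the bundle with fibre \<open>Y\<close>, but the tube map of \<open>\<rho>\<close> lives on
  the bundle with fibre \<open>V\<close>; invariance of \<open>V\<close> makes the classes coincide.
\<close>

lemma assoc_class_subset_fibre:
  assumes "acts_on K H B V" and "V \<subseteq> Y" and "y \<in> V"
  shows "assoc_class K H B Y (g, y) = assoc_class K H B V (g, y)"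
  using assms unfolding assoc_class_def assoc_rel_def acts_on_def by auto

section \<open>Equivariant normal forms\<close>

theorem theorem3p1p6:
  fixes G :: "('g, 'l::lcs) lie"
    and M :: "('p, 'e::lcs) mfd" and \<phi> :: "'g \<Rightarrow> 'p \<Rightarrow> 'p"
    and N :: "('q, 'f::lcs) mfd" and \<psi> :: "'g \<Rightarrow> 'q \<Rightarrow> 'q"
    and f :: "'p \<Rightarrow> 'q" and m :: 'p and \<mu> :: 'q and S :: "'p set"
  assumes "lie_group G"
    and "frechet_manifold M" and "g_manifold G M \<phi>"
    and "frechet_manifold N" and "g_manifold G N \<psi>"
    and "smooth_map M (points M) N f" and "equivariant_on G \<phi> \<psi> (points M) f"
    and "m \<in> points M" and "\<mu> = f m"
    and "lie_subgroup G (stabilizer G \<psi> \<mu>)"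
    and "proper_action (isotropy G \<psi> \<mu>) M \<phi>"
    and "slice TYPE('z::lcs) (isotropy G \<psi> \<mu>) M \<phi> m S"
    and "linearizable TYPE('w::lcs) (isotropy (isotropy G \<psi> \<mu>) \<phi> m) N \<psi> \<mu>"
    and "has_normal_form_equivariantly TYPE('x::lcs) TYPE('y::lcs)
           (isotropy (isotropy G \<psi> \<mu>) \<phi> m) (submfd M S) \<phi> N \<psi> f m"
  shows "has_equivariant_normal_form TYPE('x) TYPE('y) G M \<phi> N \<psi> f m"
proof -
  define K where "K = isotropy G \<psi> \<mu>"
  define Hm where "Hm = isotropy K \<phi> m"
  define H where "H = carrier Hm"
  have H_eq: "H = stabilizer K \<phi> m"
    by (simp add: H_def Hm_def)
  have K_eqs: "mult K = mult G" "one K = one G"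
    by (simp_all add: K_def)
  have Hm_eqs: "mult Hm = mult K" "one Hm = one K"
    by (simp_all add: Hm_def)
  have K_carrier: "carrier K \<subseteq> carrier G"
    by (auto simp: K_def stabilizer_def)
  have lieK: "lie_group K"
    using assms(10) unfolding lie_subgroup_def K_def isotropy_def by blast
  then have grpK: "group K"
    unfolding lie_group_def by blast
  have sl: "slice TYPE('z) K M \<phi> m S"
    using assms(12) unfolding K_def .
  then have "lie_subgroup K H"
    unfolding slice_def H_eq by - (elim conjE, assumption)
  then have subH: "subgroup H K" and lieH: "lie_group Hm"
    unfolding lie_subgroup_def H_eq Hm_def isotropy_def by auto
  have HK: "H \<subseteq> carrier K"
    using subH by (rule subgroup.subset)
  have M: "manifold M" "group_action G (points M) \<phi>"
    and N: "manifold N" "group_action G (points N) \<psi>"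
    using assms(3,5) unfolding g_manifold_def by auto
  have subK: "subgroup (carrier K) G"
    using assms(10) unfolding lie_subgroup_def K_def by simp
  have actM: "group_action K (points M) \<phi>"
    by (rule group_action_subgroup[OF M(2) subK grpK refl K_eqs(1)])
  have actN: "group_action K (points N) \<psi>"
    by (rule group_action_subgroup[OF N(2) subK grpK refl K_eqs(1)])
  obtain nf :: "('x, 'y) normal_form" and U \<kappa> V' \<rho> V A B
    where nf: "in_normal_form (submfd M S) N f m nf U \<kappa> V' \<rho> V"
      and data: "equivariant_nf_data Hm nf A B"
      and inv: "invariant_set Hm \<phi> U" "invariant_set Hm \<psi> V'"
      and eq: "equivariant_on Hm \<phi> A U \<kappa>" "equivariant_on Hm \<psi> B V' \<rho>"
    using assms(14) unfolding has_normal_form_equivariantly_def Hm_def K_def by blast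
  define D where "D = nf_dom nf"
  define \<iota> where "\<iota> = inv_into U \<kappa>"
  have anf: "abstract_normal_form nf" and ch\<kappa>: "chart_at (submfd M S) m U \<kappa> D (nf_X nf)"
    and ch\<rho>: "chart_at N (f m) V' \<rho> V (nf_Y nf)" and fU: "f ` U \<subseteq> V'"
    and nfm: "\<And>x. x \<in> D \<Longrightarrow> nf_map nf x = \<rho> (f (\<iota> x))"
    using nf unfolding in_normal_form_def D_def \<iota>_def by auto
  have linA: "linear_action Hm (nf_X nf) A" and linB: "linear_action Hm (nf_Y nf) B"
    and invD: "invariant_set Hm A D"
    using data unfolding equivariant_nf_data_def D_def by auto
  have D0: "0 \<in> D"
    using anf unfolding abstract_normal_form_def D_def by blast
  have mU: "m \<in> U" and \<kappa>m: "\<kappa> m = 0" and d\<kappa>: "diffeo (submfd M S) U (lcs_mfd (nf_X nf)) D \<kappa>"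
    and sX: "subspace (nf_X nf)"
    using ch\<kappa> unfolding chart_at_def by auto
  have d\<rho>: "diffeo N V' (lcs_mfd (nf_Y nf)) V \<rho>"
    using ch\<rho> unfolding chart_at_def by auto
  have b\<kappa>: "inj_on \<kappa> U" "\<kappa> ` U = D" and oU: "openin (mtop (submfd M S)) U"
    and oD: "openin (mtop (lcs_mfd (nf_X nf))) D"
    using d\<kappa> unfolding diffeo_def bij_betw_def by auto
  have b\<rho>: "inj_on \<rho> V'" "\<rho> ` V' = V" and oV': "openin (mtop N) V'"
    and oV: "openin (mtop (lcs_mfd (nf_Y nf))) V"
    using d\<rho> unfolding diffeo_def bij_betw_def by auto
  have DX: "D \<subseteq> nf_X nf" and VY: "V \<subseteq> nf_Y nf" and V'N: "V' \<subseteq> points N"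
    using openin_subset[OF oD] openin_subset[OF oV] openin_subset[OF oV']
    by (simp_all add: lcs_mfd_def)
  have UM: "U \<subseteq> points M"
    using openin_subset[OF oU] by (auto simp: points_submfd)
  have \<iota>U: "\<iota> x \<in> U" and \<kappa>\<iota>: "\<kappa> (\<iota> x) = x" if "x \<in> D" for x
    using that b\<kappa> unfolding \<iota>_def by (auto simp: inv_into_into f_inv_into_f)
  have \<iota>\<kappa>: "\<iota> (\<kappa> p) = p" if "p \<in> U" for p
    using that b\<kappa> unfolding \<iota>_def by simp
  have \<iota>0: "\<iota> 0 = m"
    using \<iota>\<kappa>[OF mU] \<kappa>m by simp
  have \<iota>eq: "\<iota> (A h x) = \<phi> h (\<iota> x)" if "h \<in> H" "x \<in> D" for h x
  proof -
    have "\<phi> h (\<iota> x) \<in> U"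
      using inv(1) that \<iota>U unfolding invariant_set_def H_def by blast
    moreover have "\<kappa> (\<phi> h (\<iota> x)) = A h x"
      using eq(1) that \<iota>U \<kappa>\<iota> unfolding equivariant_on_def H_def by simp
    ultimately show ?thesis
      using \<iota>\<kappa> by metis
  qed
  have tM: "topological_atlas M"
    using M(1) by (rule manifold_topological_atlas)
  have d\<iota>: "diffeo (lcs_mfd (nf_X nf)) D (submfd M U) U \<iota>"
  proof (rule diffeo_into_open_piece[OF open_piece_submfd[OF tM oU]])
    show "diffeo (lcs_mfd (nf_X nf)) D (submfd M S) U \<iota>"
      unfolding \<iota>_def
      by (rule diffeo_inv_into[OF d\<kappa> topological_atlas_submfd topological_atlas_lcs_mfd[OF sX]])
    show "U \<subseteq> points (submfd M U)"
      using UM by (auto simp: points_submfd)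
  qed
  \<comment> \<open>The given slice need not lie in the chart domain \<open>U\<close>, so \<open>U\<close> itself is the new slice.\<close>
  have slU: "slice TYPE('x) K M \<phi> m U"
  proof (rule slice_open_subset[OF lieK M(1) actM sl oU mU])
    show "\<forall>h\<in>stabilizer K \<phi> m. \<phi> h ` U \<subseteq> U"
      using inv(1) unfolding invariant_set_def Hm_def by simp
    show "equivariant_on (isotropy K \<phi> m) A \<phi> D \<iota>"
      using \<iota>eq unfolding equivariant_on_def H_eq by simp
  qed (use linA D0 invD d\<iota> \<iota>0 in \<open>simp_all add: Hm_def\<close>)
  have comp: "compact_space (gtop Hm)"
    unfolding Hm_def by (rule compact_isotropy[OF lieK _ assms(8)]) (use assms(11) K_def in simp)
  have fV': "f (\<iota> x) \<in> V'" if "x \<in> D" for x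
    using fU \<iota>U that by blast
  have feq: "f (\<phi> g p) = \<psi> g (f p)" if "g \<in> carrier K" "p \<in> points M" for g p
    using assms(7) K_carrier that unfolding equivariant_on_def by blast
  have nfV: "nf_map nf x \<in> V" if "x \<in> D" for x
    using nfm fV' b\<rho> that by blast
  \<comment> \<open>\<open>nf_map\<close> is a coordinate expression of \<open>f\<close>, so it inherits equivariance from \<open>\<iota>\<close>, \<open>f\<close> and \<open>\<rho>\<close>.\<close>
  have nfeq: "nf_map nf (A h x) = B h (nf_map nf x)" if "h \<in> H" "x \<in> D" for h x
  proof -
    have "A h x \<in> D"
      using invD that unfolding invariant_set_def H_def by blast
    then have "nf_map nf (A h x) = \<rho> (f (\<phi> h (\<iota> x)))"
      using that nfm \<iota>eq by simp
    also have "\<dots> = \<rho> (\<psi> h (f (\<iota> x)))"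
      using feq HK that \<iota>U UM by (metis subsetD)
    also have "\<dots> = B h (nf_map nf x)"
      using eq(2) fV' that nfm unfolding equivariant_on_def H_def by simp
    finally show ?thesis .
  qed
  have invV: "invariant_set Hm B V"
    unfolding invariant_set_def
  proof (intro ballI image_subsetI)
    fix h y assume h: "h \<in> carrier Hm" and "y \<in> V"
    then obtain q where q: "q \<in> V'" "y = \<rho> q"
      using b\<rho> by blast
    then have "B h y = \<rho> (\<psi> h q)"
      using eq(2) h unfolding equivariant_on_def by simp
    moreover have "\<psi> h q \<in> V'"
      using inv(2) h q unfolding invariant_set_def by blast
    ultimately show "B h y \<in> V"
      using b\<rho> by blast
  qed
  have actHM: "group_action Hm (points M) \<phi>"
    using lieH subH group_action_subgroup[OF actM subH _ _ Hm_eqs(1)]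
    unfolding lie_group_def H_def by auto
  have onD: "acts_on K H A D" and onY: "acts_on K H B (nf_Y nf)" and onV: "acts_on K H B V"
    and onU: "acts_on K H \<phi> U"
  proof -
    have X: "group_action Hm (nf_X nf) A" and Y: "group_action Hm (nf_Y nf) B"
      using linA linB unfolding linear_action_def by auto
    have "invariant_set Hm B (nf_Y nf)"
      using group_action.element_image[OF Y] unfolding invariant_set_def by blast
    then show "acts_on K H B (nf_Y nf)"
      unfolding H_def by (intro acts_on_invariant_subset[OF Y _ _ Hm_eqs]) auto
    show "acts_on K H A D" "acts_on K H B V" "acts_on K H \<phi> U"
      unfolding H_def
      by (fact acts_on_invariant_subset[OF X DX invD Hm_eqs]
          acts_on_invariant_subset[OF Y VY invV Hm_eqs]
          acts_on_invariant_subset[OF actHM UM inv(1) Hm_eqs])+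
  qed
  have onM: "acts_on K (carrier K) \<phi> (points M)" and onN: "acts_on K (carrier K) \<psi> (points N)"
    using acts_on_invariant_subset[OF actM order_refl _ refl refl]
      acts_on_invariant_subset[OF actN order_refl _ refl refl]
      group_action.element_image[OF actM] group_action.element_image[OF actN]
    unfolding invariant_set_def by blast+
  have tube_eq: "assoc_map K H B (nf_Y nf) (nf_map nf) C \<in> assoc_bundle K H B V \<and>
       f (tube_map \<phi> id (assoc_map K H \<phi> U \<iota> C)) =
         tube_map \<psi> (inv_into V' \<rho>) (assoc_map K H B (nf_Y nf) (nf_map nf) C)"
    if C: "C \<in> assoc_bundle K H A D" for C
  proof -
    obtain g x where gx: "g \<in> carrier K" "x \<in> D" and C_eq: "C = assoc_class K H A D (g, x)"
      using C unfolding assoc_bundle_def assoc_class_def by (auto elim: quotientE)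
    have "assoc_map K H B (nf_Y nf) (nf_map nf) C = assoc_class K H B (nf_Y nf) (g, nf_map nf x)"
      unfolding C_eq
      by (rule assoc_map_assoc_class[OF grpK subH onD onY gx]) (use nfV VY nfeq in auto)
    also have "\<dots> = assoc_class K H B V (g, nf_map nf x)"
      using onV VY nfV[OF gx(2)] by (rule assoc_class_subset_fibre)
    finally have NF: "assoc_map K H B (nf_Y nf) (nf_map nf) C
        = assoc_class K H B V (g, nf_map nf x)" .
    have "tube_map \<psi> (inv_into V' \<rho>) (assoc_class K H B V (g, nf_map nf x))
        = \<psi> g (inv_into V' \<rho> (nf_map nf x))"
    proof (rule tube_map_assoc_class[OF grpK subH onV onN gx(1) nfV[OF gx(2)]])
      fix y assume "y \<in> V"
      then obtain q where q: "q \<in> V'" "y = \<rho> q"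
        using b\<rho> by blast
      then show "inv_into V' \<rho> y \<in> points N"
        using b\<rho> V'N by auto
      fix h assume h: "h \<in> H"
      then have "\<psi> h q \<in> V'"
        using inv(2) q unfolding invariant_set_def H_def by blast
      moreover have "B h y = \<rho> (\<psi> h q)"
        using eq(2) h q unfolding equivariant_on_def H_def by simp
      ultimately show "inv_into V' \<rho> (B h y) = \<psi> h (inv_into V' \<rho> y)"
        using b\<rho> q by simp
    qed
    also have "\<dots> = \<psi> g (f (\<iota> x))"
      using nfm gx(2) fV' b\<rho> by simp
    also have "\<dots> = f (\<phi> g (\<iota> x))"
      using feq gx \<iota>U UM by (metis subsetD)
    also have "\<phi> g (\<iota> x) = tube_map \<phi> id (assoc_map K H \<phi> U \<iota> C)"
    proof -
      have "assoc_map K H \<phi> U \<iota> C = assoc_class K H \<phi> U (g, \<iota> x)"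
        unfolding C_eq
        by (rule assoc_map_assoc_class[OF grpK subH onD onU gx]) (use \<iota>U \<iota>eq in auto)
      moreover have "tube_map \<phi> id (assoc_class K H \<phi> U (g, \<iota> x)) = \<phi> g (id (\<iota> x))"
        by (rule tube_map_assoc_class[OF grpK subH onU onM gx(1) \<iota>U[OF gx(2)]]) (use UM in auto)
      ultimately show ?thesis
        by simp
    qed
    finally have "f (tube_map \<phi> id (assoc_map K H \<phi> U \<iota> C)) =
        tube_map \<psi> (inv_into V' \<rho>) (assoc_map K H B (nf_Y nf) (nf_map nf) C)"
      unfolding NF by simp
    moreover have "assoc_map K H B (nf_Y nf) (nf_map nf) C \<in> assoc_bundle K H B V"
      unfolding NF assoc_bundle_def assoc_class_def using gx nfV by (auto intro: quotientI)
    ultimately show ?thesis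
      by blast
  qed
  have "abstract_equivariant_normal_form Hm nf A B"
    using lieH comp anf data unfolding abstract_equivariant_normal_form_def by blast
  moreover have "equivariant_on Hm A \<phi> D \<iota>"
    using \<iota>eq unfolding equivariant_on_def H_def by blast
  ultimately show ?thesis
    unfolding has_equivariant_normal_form_def Let_def assms(9)[symmetric]
    unfolding K_def[symmetric]
    unfolding Hm_def[symmetric]
    unfolding H_def[symmetric]
    using slU d\<iota> \<iota>0 ch\<rho> inv(2) eq(2) fU tube_eq assms(9) unfolding D_def
    by (intro exI[of _ nf] exI[of _ A] exI[of _ B] exI[of _ U] exI[of _ \<iota>] exI[of _ V'] exI[of _ \<rho>]
      exI[of _ V] conjI ballI) auto
qed

end
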